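(* Let $f_1,\dots,f_s$ be nonzero elements of $\mathbf F=\mathbb K[\![x_1,\dots,x_n]\!]$ and let $\mathbf A=\mathbb K[\![f_1,\dots,f_s]\!]$. Assume that $\mathrm{exp}(\mathbf A,a)$ is finitely generated for all $a\in U^n$, and that the set $\{\mathrm M(\mathbf A,a)\mid a\in U^n\}$ is finite. Then there exists a partition $\mathcal P$ of $U^n$ into convex rational polyhedral cones such that for all $\sigma\in\mathcal P$, $\mathrm{exp}(\mathbf A,a)$ and $\mathrm{in}(\mathbf A,a)$ do not depend on $a\in\sigma$.
   Context: $\mathbb K$ is a field, $n\ge 1$, $\underline x=(x_1,\dots,x_n)$, $\mathbf F=\mathbb K[\![x_1,\dots,x_n]\!]$, $U=\mathbb R_{>0}$. Fix a total well ordering $\prec$ on $\mathbb N^n$ compatible with sums. For $a\in U^n$ and a nonzero $f=\sum c_\alpha\underline x^\alpha\in\mathbf F$: $\mathrm{Supp}(f)=\{\alpha\mid c_\alpha\ne0\}$; $\nu(f,a)=\min\{a\cdot\alpha\mid\alpha\in\mathrm{Supp}(f)\}$; $\mathrm{in}(f,a)=\sum_{\alpha\in\mathrm{Supp}(f),\,a\cdot\alpha=\nu(f,a)}c_\alpha\underline x^\alpha$ (a polynomial); $\mathrm{exp}(f,a)=\max_\prec\mathrm{Supp}(\mathrm{in}(f,a))$; $\mathrm M(f,a)=c_{\mathrm{exp}(f,a)}\underline x^{\mathrm{exp}(f,a)}$. For $S\subseteq\mathbf F$, $\mathbb K[\![S]\!]$ is the closure, in the $(x_1,\dots,x_n)$-adic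 topology, of the $\mathbb K$-subalgebra of $\mathbf F$ generated by $S$ (for a finite set $\{f_1,\dots,f_s\}$ of series without constant term it is the set of all formal power series in $f_1,\dots,f_s$). For a subalgebra $\mathbf A=\mathbb K[\![f_1,\dots,f_s]\!]$: $\mathrm{in}(\mathbf A,a)=\mathbb K[\![\mathrm{in}(f,a), f\in\mathbf A\setminus\{0\}]\!]$, $\mathrm M(\mathbf A,a)=\mathbb K[\![\mathrm M(f,a), f\in\mathbf A\setminus\{0\}]\!]$, and $\mathrm{exp}(\mathbf A,a)=\{\mathrm{exp}(f,a)\mid f\in\mathbf A\setminus\{0\}\}$, a subsemigroup of $\mathbb N^n$ containing $0$. Cones of the partition are not required to be closed: a convex rational polyhedral cone in $U^n$ is a convex subset of $U^n$, stable under multiplication by positive reals, defined in $U^n$ by finitely many homogeneous linear equations and (strict or non-strict) inequalities with rational coefficients. *)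

theory Defs
  imports "HOL-Analysis.Analysis" "HOL-Library.Disjoint_Sets"
begin

section \<open>Formal power series in finitely many variables\<close>

text \<open>
  Variables are indexed by a finite type \<open>'n\<close> and exponents are vectors of type \<open>nat ^ 'n\<close>.
\<close>

typedef (overloaded) ('k, 'n::finite) mfps = "UNIV :: (nat ^ 'n \<Rightarrow> 'k) set"
  morphisms coeff Mfps ..

lemma coeff_Mfps [simp]: "coeff (Mfps c) \<alpha> = c \<alpha>"
  by (simp add: Mfps_inverse)

lemma mfps_eqI: "(\<And>\<alpha>. coeff f \<alpha> = coeff g \<alpha>) \<Longrightarrow> f = g"
  by (metis coeff_inject ext)

definition antidiag :: "nat ^ 'n \<Rightarrow> ((nat ^ 'n) \<times> (nat ^ 'n::finite)) set" where
  "antidiag \<gamma> = {(\<alpha>, \<beta>). \<alpha> + \<beta> = \<gamma>}"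

lemma finite_antidiag [simp]: "finite (antidiag \<gamma>)"
proof -
  define B where "B = vec_lambda ` (PiE UNIV (\<lambda>i. {..\<gamma> $ i}))"
  have "finite B" unfolding B_def by (intro finite_imageI finite_PiE) auto
  moreover have "antidiag \<gamma> \<subseteq> B \<times> B"
  proof clarify
    fix \<alpha> \<beta> assume "(\<alpha>, \<beta>) \<in> antidiag \<gamma>"
    then have "\<gamma> = \<alpha> + \<beta>" by (simp add: antidiag_def)
    then have "vec_nth \<alpha> \<in> PiE UNIV (\<lambda>i. {..\<gamma> $ i})" "vec_nth \<beta> \<in> PiE UNIV (\<lambda>i. {..\<gamma> $ i})"
      by auto
    then have "vec_lambda (vec_nth \<alpha>) \<in> B" "vec_lambda (vec_nth \<beta>) \<in> B"
      unfolding B_def by blast+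
    then show "\<alpha> \<in> B \<and> \<beta> \<in> B" by simp
  qed
  ultimately show ?thesis by (meson finite_SigmaI finite_subset)
qed

instantiation mfps :: (comm_ring_1, finite) comm_ring_1
begin

definition zero_mfps :: "('a, 'b) mfps" where
  "0 = Mfps (\<lambda>_. 0)"

definition one_mfps :: "('a, 'b) mfps" where
  "1 = Mfps (\<lambda>\<alpha>. if \<alpha> = 0 then 1 else 0)"

definition plus_mfps :: "('a, 'b) mfps \<Rightarrow> ('a, 'b) mfps \<Rightarrow> ('a, 'b) mfps" where
  "f + g = Mfps (\<lambda>\<alpha>. coeff f \<alpha> + coeff g \<alpha>)"

definition uminus_mfps :: "('a, 'b) mfps \<Rightarrow> ('a, 'b) mfps" where
  "- f = Mfps (\<lambda>\<alpha>. - coeff f \<alpha>)"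

definition minus_mfps :: "('a, 'b) mfps \<Rightarrow> ('a, 'b) mfps \<Rightarrow> ('a, 'b) mfps" where
  "f - g = Mfps (\<lambda>\<alpha>. coeff f \<alpha> - coeff g \<alpha>)"

definition times_mfps :: "('a, 'b) mfps \<Rightarrow> ('a, 'b) mfps \<Rightarrow> ('a, 'b) mfps" where
  "f * g = Mfps (\<lambda>\<gamma>. \<Sum>(\<alpha>, \<beta>)\<in>antidiag \<gamma>. coeff f \<alpha> * coeff g \<beta>)"

instance
proof
  fix f g h :: "('a, 'b) mfps"
  show "f + g + h = f + (g + h)" "f + g = g + f" "0 + f = f" "- f + f = 0" "f - g = f + - g"
    by (auto intro!: mfps_eqI
        simp: plus_mfps_def zero_mfps_def uminus_mfps_def minus_mfps_def add_ac)
  show "(f + g) * h = f * h + g * h"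
    by (auto intro!: mfps_eqI
        simp: plus_mfps_def times_mfps_def distrib_right sum.distrib case_prod_unfold)
  show "f * g = g * f"
  proof (rule mfps_eqI)
    fix \<gamma>
    show "coeff (f * g) \<gamma> = coeff (g * f) \<gamma>"
      unfolding times_mfps_def coeff_Mfps
      by (rule sum.reindex_bij_witness[of _ prod.swap prod.swap])
         (auto simp: antidiag_def add.commute mult.commute)
  qed
  show "1 * f = f"
  proof (rule mfps_eqI)
    fix \<gamma>
    have "coeff (1 * f) \<gamma> =
        (\<Sum>p\<in>antidiag \<gamma>. if p = (0, \<gamma>) then coeff f \<gamma> else 0)"
      unfolding times_mfps_def one_mfps_def coeff_Mfps
      by (rule sum.cong) (auto simp: antidiag_def split: if_splits)
    also have "\<dots> = coeff f \<gamma>"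
      by (subst sum.delta, rule finite_antidiag) (simp add: antidiag_def)
    finally show "coeff (1 * f) \<gamma> = coeff f \<gamma>" .
  qed
  show "f * g * h = f * (g * h)"
  proof (rule mfps_eqI)
    fix \<gamma>
    have "coeff (f * g * h) \<gamma> =
        (\<Sum>(p, q)\<in>(SIGMA p:antidiag \<gamma>. antidiag (fst p)).
          coeff f (fst q) * coeff g (snd q) * coeff h (snd p))"
      unfolding times_mfps_def coeff_Mfps
      by (simp add: sum_distrib_right case_prod_unfold,
          subst sum.Sigma) (simp_all add: case_prod_unfold)
    also have "\<dots> = (\<Sum>(p, q)\<in>(SIGMA p:antidiag \<gamma>. antidiag (snd p)).
          coeff f (fst p) * (coeff g (fst q) * coeff h (snd q)))"
      by (rule sum.reindex_bij_witness[of _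
            "\<lambda>((a, _), (b, c)). ((a + b, c), (a, b))"
            "\<lambda>((_, c), (a, b)). ((a, b + c), (b, c))"])
         (auto simp: antidiag_def add.assoc mult.assoc)
    also have "\<dots> = coeff (f * (g * h)) \<gamma>"
      unfolding times_mfps_def coeff_Mfps
      by (simp add: sum_distrib_left case_prod_unfold,
          subst sum.Sigma) (simp_all add: case_prod_unfold)
    finally show "coeff (f * g * h) \<gamma> = coeff (f * (g * h)) \<gamma>" .
  qed
  show "(0::('a, 'b) mfps) \<noteq> 1"
  proof
    assume "(0::('a, 'b) mfps) = 1"
    then have "coeff (0::('a, 'b) mfps) 0 = coeff (1::('a, 'b) mfps) 0" by simp
    then show False by (simp add: zero_mfps_def one_mfps_def)
  qed
qed

end

lemma coeff_0 [simp]: "coeff 0 \<alpha> = 0"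
  and coeff_1: "coeff 1 \<alpha> = (if \<alpha> = 0 then 1 else 0)"
  and coeff_add [simp]: "coeff (f + g) \<alpha> = coeff f \<alpha> + coeff g \<alpha>"
  and coeff_uminus [simp]: "coeff (- f) \<alpha> = - coeff f \<alpha>"
  and coeff_diff [simp]: "coeff (f - g) \<alpha> = coeff f \<alpha> - coeff g \<alpha>"
  and coeff_mult: "coeff (f * g) \<gamma> = (\<Sum>(\<alpha>, \<beta>)\<in>antidiag \<gamma>. coeff f \<alpha> * coeff g \<beta>)"
  by (simp_all add: zero_mfps_def one_mfps_def plus_mfps_def uminus_mfps_def minus_mfps_def
      times_mfps_def)

lemma coeff_sum: "coeff (\<Sum>x\<in>A. f x) \<alpha> = (\<Sum>x\<in>A. coeff (f x) \<alpha>)"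
  by (induction A rule: infinite_finite_induct) auto

definition monom :: "'k::comm_ring_1 \<Rightarrow> nat ^ 'n::finite \<Rightarrow> ('k, 'n) mfps" where
  "monom c \<alpha> = Mfps (\<lambda>\<beta>. if \<beta> = \<alpha> then c else 0)"

lemma coeff_monom: "coeff (monom c \<alpha>) \<beta> = (if \<beta> = \<alpha> then c else 0)"
  by (simp add: monom_def)

definition Const :: "'k::comm_ring_1 \<Rightarrow> ('k, 'n::finite) mfps" where
  "Const c = monom c 0"

definition Var :: "'n::finite \<Rightarrow> ('k::comm_ring_1, 'n) mfps" where
  "Var i = monom 1 (axis i 1)"

lemma coeff_monom_mult:
  "coeff (monom c \<alpha> * f) \<gamma> = (if \<forall>i. \<alpha> $ i \<le> \<gamma> $ i then c * coeff f (\<gamma> - \<alpha>) else 0)"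
proof -
  have *: "\<alpha> + (\<gamma> - \<alpha>) = \<gamma>" if "\<forall>i. \<alpha> $ i \<le> \<gamma> $ i"
    using that by (simp add: vec_eq_iff)
  have "coeff (monom c \<alpha> * f) \<gamma> =
      (\<Sum>p\<in>antidiag \<gamma>. if p = (\<alpha>, \<gamma> - \<alpha>) then c * coeff f (\<gamma> - \<alpha>) else 0)"
    unfolding coeff_mult by (rule sum.cong) (auto simp: antidiag_def coeff_monom split: if_splits)
  also have "\<dots> = (if (\<alpha>, \<gamma> - \<alpha>) \<in> antidiag \<gamma> then c * coeff f (\<gamma> - \<alpha>) else 0)"
    by (subst sum.delta) auto
  also have "(\<alpha>, \<gamma> - \<alpha>) \<in> antidiag \<gamma> \<longleftrightarrow> (\<forall>i. \<alpha> $ i \<le> \<gamma> $ i)"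
  proof
    assume "(\<alpha>, \<gamma> - \<alpha>) \<in> antidiag \<gamma>"
    then have "\<alpha> $ i + (\<gamma> - \<alpha>) $ i = \<gamma> $ i" for i
      by (simp add: antidiag_def vec_eq_iff)
    then show "\<forall>i. \<alpha> $ i \<le> \<gamma> $ i" by (metis le_add1)
  qed (use * in \<open>simp add: antidiag_def\<close>)
  finally show ?thesis .
qed


section \<open>The adic topology\<close>

text \<open>\<open>mpow N\<close> is the \<open>N\<close>-th power of the ideal generated by the variables.\<close>

primrec mpow :: "nat \<Rightarrow> ('k::comm_ring_1, 'n::finite) mfps set" where
  "mpow 0 = UNIV"
| "mpow (Suc N) = {(\<Sum>i\<in>UNIV. Var i * h i) | h. \<forall>i. h i \<in> mpow N}"

lemma mpow_iff:
  fixes f :: "('k::comm_ring_1, 'n::finite) mfps"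
  shows "f \<in> mpow N \<longleftrightarrow> (\<forall>\<alpha>. (\<Sum>i\<in>UNIV. \<alpha> $ i) < N \<longrightarrow> coeff f \<alpha> = 0)"
proof (induction N arbitrary: f)
  case 0
  then show ?case by simp
next
  case (Suc N)
  have ax: "(\<forall>j. axis i (1::nat) $ j \<le> \<alpha> $ j) \<longleftrightarrow> 0 < \<alpha> $ i" for i and \<alpha> :: "nat ^ 'n"
    by (auto simp: axis_def Suc_le_eq)
  have cf: "coeff (\<Sum>i\<in>UNIV. Var i * h i) \<alpha> =
      (\<Sum>i\<in>UNIV. if 0 < \<alpha> $ i then coeff (h i) (\<alpha> - axis i 1) else 0)"
    for h :: "'n \<Rightarrow> ('k, 'n) mfps" and \<alpha>
    unfolding coeff_sum Var_def coeff_monom_mult ax mult_1_left ..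
  have deg: "(\<Sum>j\<in>UNIV. \<alpha> $ j) = Suc (\<Sum>j\<in>UNIV. (\<alpha> - axis i 1) $ j)"
    if "0 < \<alpha> $ i" for i and \<alpha> :: "nat ^ 'n"
    using that by (simp add: axis_def sum.remove[of UNIV i])
  show ?case
  proof
    assume "f \<in> mpow (Suc N)"
    then obtain h where h: "f = (\<Sum>i\<in>UNIV. Var i * h i)" "\<And>i. h i \<in> mpow N" by auto
    show "\<forall>\<alpha>. (\<Sum>i\<in>UNIV. \<alpha> $ i) < Suc N \<longrightarrow> coeff f \<alpha> = 0"
    proof (intro allI impI)
      fix \<alpha> :: "nat ^ 'n" assume lt: "(\<Sum>i\<in>UNIV. \<alpha> $ i) < Suc N"
      have "coeff (h i) (\<alpha> - axis i 1) = 0" if "0 < \<alpha> $ i" for i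
        using h(2)[of i] lt deg[OF that] Suc.IH by simp
      then show "coeff f \<alpha> = 0"
        unfolding h(1) cf by (intro sum.neutral) simp
    qed
  next
    assume *: "\<forall>\<alpha>. (\<Sum>i\<in>UNIV. \<alpha> $ i) < Suc N \<longrightarrow> coeff f \<alpha> = 0"
    define k where "k \<alpha> = (SOME i. 0 < \<alpha> $ i)" for \<alpha> :: "nat ^ 'n"
    define h :: "'n \<Rightarrow> ('k, 'n) mfps" where
      "h i = Mfps (\<lambda>\<beta>. if k (\<beta> + axis i 1) = i then coeff f (\<beta> + axis i 1) else 0)" for i
    have "h i \<in> mpow N" for i
    proof -
      have "coeff (h i) \<beta> = 0" if "(\<Sum>j\<in>UNIV. \<beta> $ j) < N" for \<beta>
      proof -
        have "(\<Sum>j\<in>UNIV. (\<beta> + axis i 1) $ j) < Suc N"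
          using deg[of "\<beta> + axis i 1" i] that by (simp add: axis_def)
        then show ?thesis using * by (simp add: h_def)
      qed
      then show ?thesis using Suc.IH by blast
    qed
    moreover have "f = (\<Sum>i\<in>UNIV. Var i * h i)"
    proof (rule mfps_eqI)
      fix \<alpha> :: "nat ^ 'n"
      have add: "\<alpha> - axis i 1 + axis i 1 = \<alpha>" if "0 < \<alpha> $ i" for i
        using that by (auto simp: vec_eq_iff axis_def)
      have "coeff (\<Sum>i\<in>UNIV. Var i * h i) \<alpha> =
          (\<Sum>i\<in>UNIV. if 0 < \<alpha> $ i \<and> k \<alpha> = i then coeff f \<alpha> else 0)"
        unfolding cf by (rule sum.cong) (auto simp: h_def add[simplified])
      also have "\<dots> = (\<Sum>i\<in>UNIV. if i = k \<alpha> then (if 0 < \<alpha> $ k \<alpha> then coeff f \<alpha> else 0) else 0)"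
        by (rule sum.cong) auto
      also have "\<dots> = (if 0 < \<alpha> $ k \<alpha> then coeff f \<alpha> else 0)"
        by (subst sum.delta) auto
      also have "\<dots> = coeff f \<alpha>"
      proof (cases "\<exists>i. 0 < \<alpha> $ i")
        case True
        then have "0 < \<alpha> $ k \<alpha>" unfolding k_def by (rule someI_ex)
        then show ?thesis by simp
      next
        case False
        then show ?thesis using * by simp
      qed
      finally show "coeff f \<alpha> = coeff (\<Sum>i\<in>UNIV. Var i * h i) \<alpha>" by simp
    qed
    ultimately show "f \<in> mpow (Suc N)" by auto
  qed
qed

instantiation mfps :: (comm_ring_1, finite) topological_space
begin

definition open_mfps :: "('a, 'b) mfps set \<Rightarrow> bool" where
  "open W \<longleftrightarrow> (\<forall>f\<in>W. \<exists>N. \<forall>g. g - f \<in> mpow N \<longrightarrow> g \<in> W)"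

instance
proof
  show "open (UNIV :: ('a, 'b) mfps set)" by (simp add: open_mfps_def)
next
  fix S T :: "('a, 'b) mfps set"
  assume ST: "open S" "open T"
  show "open (S \<inter> T)"
    unfolding open_mfps_def
  proof
    fix f assume "f \<in> S \<inter> T"
    then obtain M N where "\<And>g. g - f \<in> mpow M \<Longrightarrow> g \<in> S" "\<And>g. g - f \<in> mpow N \<Longrightarrow> g \<in> T"
      using ST unfolding open_mfps_def by blast
    moreover have "g - f \<in> mpow M \<and> g - f \<in> mpow N" if "g - f \<in> mpow (max M N)" for g
      using that unfolding mpow_iff by auto
    ultimately show "\<exists>N. \<forall>g. g - f \<in> mpow N \<longrightarrow> g \<in> S \<inter> T" by blast
  qed
next
  fix K :: "('a, 'b) mfps set set"
  assume "\<forall>S\<in>K. open S"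
  then show "open (\<Union>K)" unfolding open_mfps_def by (metis Union_iff)
qed

end

lemma closure_mfps_iff:
  fixes f :: "('k::comm_ring_1, 'n::finite) mfps"
  shows "f \<in> closure S \<longleftrightarrow> (\<forall>N. \<exists>g\<in>S. g - f \<in> mpow N)"
proof
  assume f: "f \<in> closure S"
  show "\<forall>N. \<exists>g\<in>S. g - f \<in> mpow N"
  proof
    fix N
    have "h - f \<in> mpow N" if "g - f \<in> mpow N" "h - g \<in> mpow N" for g h
      using that unfolding mpow_iff by (auto simp: algebra_simps)
    then have "open {g. g - f \<in> mpow N}" unfolding open_mfps_def by blast
    moreover have "f \<in> {g. g - f \<in> mpow N}" by (simp add: mpow_iff)
    ultimately show "\<exists>g\<in>S. g - f \<in> mpow N"
      using f unfolding closure_iff_nhds_not_empty by blast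
  qed
next
  assume *: "\<forall>N. \<exists>g\<in>S. g - f \<in> mpow N"
  show "f \<in> closure S"
    unfolding closure_iff_nhds_not_empty
  proof (intro allI impI)
    fix A V assume "V \<subseteq> A" "open V" "f \<in> V"
    then show "S \<inter> A \<noteq> {}" using * unfolding open_mfps_def by blast
  qed
qed


section \<open>Subalgebras\<close>

definition mfps_subalgebra :: "('k::comm_ring_1, 'n::finite) mfps set \<Rightarrow> bool" where
  "mfps_subalgebra B \<longleftrightarrow>
     range Const \<subseteq> B \<and> (\<forall>f\<in>B. \<forall>g\<in>B. f + g \<in> B) \<and> (\<forall>f\<in>B. \<forall>g\<in>B. f * g \<in> B)"

definition powser_alg :: "('k::comm_ring_1, 'n::finite) mfps set \<Rightarrow> ('k, 'n) mfps set" where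
  "powser_alg S = closure (mfps_subalgebra hull S)"

definition add_submonoid :: "(nat ^ 'n::finite) set \<Rightarrow> bool" where
  "add_submonoid H \<longleftrightarrow> 0 \<in> H \<and> (\<forall>\<alpha>\<in>H. \<forall>\<beta>\<in>H. \<alpha> + \<beta> \<in> H)"

definition fin_gen_semigroup :: "(nat ^ 'n::finite) set \<Rightarrow> bool" where
  "fin_gen_semigroup H \<longleftrightarrow> (\<exists>G. finite G \<and> H = add_submonoid hull G)"


section \<open>Initial forms and leading exponents\<close>

definition pos_weights :: "(real ^ 'n::finite) set" where
  "pos_weights = {a. \<forall>i. 0 < a $ i}"

definition wt :: "real ^ 'n::finite \<Rightarrow> nat ^ 'n \<Rightarrow> real" where
  "wt a \<alpha> = (\<Sum>i\<in>UNIV. a $ i * real (\<alpha> $ i))"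

definition Supp :: "('k::comm_ring_1, 'n::finite) mfps \<Rightarrow> (nat ^ 'n) set" where
  "Supp f = {\<alpha>. coeff f \<alpha> \<noteq> 0}"

definition nu :: "('k::comm_ring_1, 'n::finite) mfps \<Rightarrow> real ^ 'n \<Rightarrow> real" where
  "nu f a = (LEAST v. v \<in> wt a ` Supp f)"

definition init_form :: "('k::comm_ring_1, 'n::finite) mfps \<Rightarrow> real ^ 'n \<Rightarrow> ('k, 'n) mfps" where
  "init_form f a = Mfps (\<lambda>\<alpha>. if \<alpha> \<in> Supp f \<and> wt a \<alpha> = nu f a then coeff f \<alpha> else 0)"

text \<open>
  The argument \<open>r\<close> is the total order on exponents, with \<open>(\<alpha>, \<beta>) \<in> r\<close> meaning
  \<open>\<alpha> \<preceq> \<beta>\<close> (reflexive version).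
\<close>

definition max_wrt :: "(nat ^ 'n::finite) rel \<Rightarrow> (nat ^ 'n) set \<Rightarrow> nat ^ 'n" where
  "max_wrt r S = (THE \<mu>. \<mu> \<in> S \<and> (\<forall>\<alpha>\<in>S. (\<alpha>, \<mu>) \<in> r))"

definition lead_exp ::
    "(nat ^ 'n::finite) rel \<Rightarrow> ('k::comm_ring_1, 'n) mfps \<Rightarrow> real ^ 'n \<Rightarrow> nat ^ 'n" where
  "lead_exp r f a = max_wrt r (Supp (init_form f a))"

definition lead_monom ::
    "(nat ^ 'n::finite) rel \<Rightarrow> ('k::comm_ring_1, 'n) mfps \<Rightarrow> real ^ 'n \<Rightarrow> ('k, 'n) mfps" where
  "lead_monom r f a = monom (coeff f (lead_exp r f a)) (lead_exp r f a)"

definition init_alg ::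
    "('k::comm_ring_1, 'n::finite) mfps set \<Rightarrow> real ^ 'n \<Rightarrow> ('k, 'n) mfps set" where
  "init_alg A a = powser_alg {init_form f a | f. f \<in> A - {0}}"

definition lead_alg ::
    "(nat ^ 'n::finite) rel \<Rightarrow> ('k::comm_ring_1, 'n) mfps set \<Rightarrow> real ^ 'n \<Rightarrow> ('k, 'n) mfps set" where
  "lead_alg r A a = powser_alg {lead_monom r f a | f. f \<in> A - {0}}"

definition exp_set ::
    "(nat ^ 'n::finite) rel \<Rightarrow> ('k::comm_ring_1, 'n) mfps set \<Rightarrow> real ^ 'n \<Rightarrow> (nat ^ 'n) set" where
  "exp_set r A a = {lead_exp r f a | f. f \<in> A - {0}}"


section \<open>Cones\<close>

definition rational_vec :: "real ^ 'n::finite \<Rightarrow> bool" where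
  "rational_vec c \<longleftrightarrow> (\<forall>i. c $ i \<in> \<rat>)"

text \<open>\<open>E\<close>, \<open>L\<close>, \<open>N\<close> hold the equations, strict and non-strict inequalities.\<close>

definition rational_polyhedral_cone :: "(real ^ 'n::finite) set \<Rightarrow> bool" where
  "rational_polyhedral_cone C \<longleftrightarrow>
     C \<subseteq> pos_weights \<and> convex C \<and> (\<forall>a\<in>C. \<forall>t>0. t *\<^sub>R a \<in> C) \<and>
     (\<exists>E L N. finite E \<and> finite L \<and> finite N \<and> (\<forall>c\<in>E \<union> L \<union> N. rational_vec c) \<and>
        C = {a \<in> pos_weights. (\<forall>c\<in>E. c \<bullet> a = 0) \<and> (\<forall>c\<in>L. 0 < c \<bullet> a) \<and> (\<forall>c\<in>N. 0 \<le> c \<bullet> a)})"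

end

theory Submission
  imports Defs
begin

text \<open>
  Fix a weight \<open>a\<close> and put \<open>H = exp(A, a)\<close>. Since \<open>H\<close> is finitely generated, there are finitely many
  series in \<open>A\<close> whose leading exponents generate \<open>H\<close>. They can be chosen reduced: each has support
  meeting \<open>H\<close> in a single point \<open>\<gamma>\<close>, a generator of \<open>H\<close> (\<open>ex_reduced_basis\<close>). Such a series
  \<open>g\<^sub>\<gamma>\<close> then has leading exponent \<open>\<gamma>\<close> for every weight \<open>b\<close> with \<open>exp(A, b) = H\<close>, because its leading
  exponent must lie both in \<open>H\<close> and in its support. So one finite set \<open>T\<close> serves all weights with the
  same semigroup of exponents.

  Conversely, if \<open>in(g, b) = in(g, a)\<close> for all \<open>g \<in> T\<close>, then \<open>exp(A, b)\<close> contains the generators of \<open>H\<close>,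
  hence contains \<open>H\<close>; and an inclusion between two sets of exponents of \<open>A\<close> is never proper
  (\<open>exp_set_no_proper_inclusion\<close>), so \<open>exp(A, b) = H\<close>. Moreover \<open>in(A, b)\<close> is generated by the \<open>in(g, b)\<close>
  with \<open>g \<in> T\<close> (\<open>init_alg_eq_powser_alg\<close>), so \<open>in(A, b) = in(A, a)\<close> too. It follows that
  ``\<open>in(g, a) = in(g, b)\<close> for all \<open>g\<close> in the basis attached to \<open>exp(A, a)\<close>'' is an equivalence relation
  on the positive weights, and its classes form the partition.

  A class is a rational polyhedral cone because the initial form of one series is controlled by
  finitely many exponents: for positive weights only the componentwise minimal exponents of the support can
  have least weight, and there are finitely many of these by Dickson's lemma
  (\<open>init_form_constancy_conditions\<close>).

  Reduction and the absence of proper inclusions both come from a division procedure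
  (\<open>division_by_closed_subalgebra\<close>): modulo \<open>A\<close>, every power series is congruent to one without
  exponents in \<open>H\<close>. It works because, for a positive weight, the order that compares weights first
  and breaks ties by the given well order has finite initial segments, so the coefficients to be subtracted
  are found by recursion and the resulting infinite sum converges in the closed algebra \<open>A\<close>.
\<close>


section \<open>Dickson's lemma\<close>

lemma finite_below: "finite {\<beta> :: nat ^ 'n::finite. \<beta> \<le> \<alpha>}"
proof (rule finite_subset)
  show "{\<beta>. \<beta> \<le> \<alpha>} \<subseteq> fst ` antidiag \<alpha>"
  proof
    fix \<beta> assume "\<beta> \<in> {\<beta>. \<beta> \<le> \<alpha>}"
    then have "(\<beta>, \<alpha> - \<beta>) \<in> antidiag \<alpha>"
      by (auto simp: antidiag_def vec_eq_iff less_eq_vec_def)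
    then show "\<beta> \<in> fst ` antidiag \<alpha>" by force
  qed
qed simp

lemma mono_subseq_nat:
  fixes u :: "nat \<Rightarrow> nat"
  shows "\<exists>\<phi> :: nat \<Rightarrow> nat. strict_mono \<phi> \<and> mono (u \<circ> \<phi>)"
proof -
  obtain \<phi> :: "nat \<Rightarrow> nat" where \<phi>: "strict_mono \<phi>" "monoseq (\<lambda>n. u (\<phi> n))"
    using seq_monosub by blast
  show ?thesis
  proof (cases "incseq (\<lambda>n. u (\<phi> n))")
    case True
    then show ?thesis using \<phi>(1) by (intro exI[of _ \<phi>]) (simp add: comp_def)
  next
    case False
    then have dec: "decseq (\<lambda>n. u (\<phi> n))" using \<phi>(2) by (simp add: monoseq_iff)
    obtain N where N: "\<And>n. u (\<phi> N) \<le> u (\<phi> n)"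
      using ex_has_least_nat[of "\<lambda>_. True" 0 "\<lambda>n. u (\<phi> n)"] by auto
    have "u (\<phi> (n + N)) = u (\<phi> N)" for n
      using N[of "n + N"] decseqD[OF dec, of N "n + N"] by simp
    then have "mono (u \<circ> (\<lambda>n. \<phi> (n + N)))" by (simp add: mono_def)
    moreover have "strict_mono (\<lambda>n. \<phi> (n + N))"
      using \<phi>(1) by (simp add: strict_mono_def)
    ultimately show ?thesis by blast
  qed
qed

lemma mono_subseq_coordinates:
  fixes s :: "nat \<Rightarrow> nat ^ 'n::finite"
  assumes "finite I"
  shows "\<exists>\<phi> :: nat \<Rightarrow> nat. strict_mono \<phi> \<and> (\<forall>i\<in>I. mono (\<lambda>k. s (\<phi> k) $ i))"
  using assms
proof induction
  case empty
  show ?case by (auto intro: exI[of _ id] simp: strict_mono_def)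
next
  case (insert i I)
  then obtain \<phi> :: "nat \<Rightarrow> nat"
    where \<phi>: "strict_mono \<phi>" "\<forall>i\<in>I. mono (\<lambda>k. s (\<phi> k) $ i)" by blast
  obtain \<psi> :: "nat \<Rightarrow> nat" where \<psi>: "strict_mono \<psi>" "mono ((\<lambda>k. s (\<phi> k) $ i) \<circ> \<psi>)"
    using mono_subseq_nat by blast
  have "mono (\<lambda>k. s (\<phi> (\<psi> k)) $ j)" if "j \<in> insert i I" for j
    using that \<phi>(2) \<psi> strict_mono_mono[OF \<psi>(1)] by (auto simp: comp_def mono_def)
  moreover have "strict_mono (\<lambda>k. \<phi> (\<psi> k))"
    using \<phi>(1) \<psi>(1) by (simp add: strict_mono_def)
  ultimately show ?case by blast
qed

definition minimal_exps :: "(nat ^ 'n::finite) set \<Rightarrow> (nat ^ 'n) set" where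
  "minimal_exps S = {\<alpha>\<in>S. \<forall>\<beta>\<in>S. \<beta> \<le> \<alpha> \<longrightarrow> \<beta> = \<alpha>}"

text \<open>
  This is Dickson's lemma: a sequence of distinct minimal exponents would have a subsequence that
  increases in every coordinate, whose second term lies above the first.
\<close>

lemma finite_minimal_exps: "finite (minimal_exps S)"
proof (rule ccontr)
  assume "infinite (minimal_exps S)"
  then obtain s :: "nat \<Rightarrow> nat ^ 'a" where s: "inj s" "range s \<subseteq> minimal_exps S"
    using infinite_countable_subset by blast
  obtain \<phi> :: "nat \<Rightarrow> nat"
    where \<phi>: "strict_mono \<phi>" "\<forall>i\<in>UNIV. mono (\<lambda>k. s (\<phi> k) $ i)"
    using mono_subseq_coordinates[OF finite_class.finite_UNIV] by blast
  have "s (\<phi> 0) \<le> s (\<phi> 1)" using \<phi>(2) by (auto simp: less_eq_vec_def mono_def)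
  moreover have "s k \<in> minimal_exps S" for k using s(2) by blast
  ultimately have "s (\<phi> 0) = s (\<phi> 1)" by (auto simp: minimal_exps_def)
  then have "\<phi> 0 = \<phi> 1" using s(1) by (simp add: inj_eq)
  then show False using strict_monoD[OF \<phi>(1), of 0 1] by simp
qed

lemma ex_minimal_exp_below:
  assumes "\<alpha> \<in> S"
  shows "\<exists>\<beta>\<in>minimal_exps S. \<beta> \<le> \<alpha>"
proof -
  have "finite {\<beta>\<in>S. \<beta> \<le> \<alpha>}" using finite_below[of \<alpha>] by (rule rev_finite_subset) auto
  from finite_has_minimal2[OF this, of \<alpha>] assms obtain \<mu>
    where "\<mu> \<in> S" "\<mu> \<le> \<alpha>" "\<forall>\<beta>\<in>{\<beta>\<in>S. \<beta> \<le> \<alpha>}. \<beta> \<le> \<mu> \<longrightarrow> \<mu> = \<beta>" by auto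
  then show ?thesis unfolding minimal_exps_def by (auto intro: order_trans)
qed


section \<open>Weights and initial forms\<close>

lemma wt_add: "wt a (\<alpha> + \<beta>) = wt a \<alpha> + wt a \<beta>"
  by (simp add: wt_def algebra_simps sum.distrib)

lemma wt_strict_mono:
  assumes "a \<in> pos_weights" "\<alpha> \<le> \<beta>" "\<alpha> \<noteq> \<beta>"
  shows "wt a \<alpha> < wt a \<beta>"
  unfolding wt_def
proof (rule sum_strict_mono_ex1)
  show "\<forall>i\<in>UNIV. a $ i * real (\<alpha> $ i) \<le> a $ i * real (\<beta> $ i)"
    using assms(1,2) by (auto simp: pos_weights_def less_eq_vec_def intro!: mult_left_mono less_imp_le)
  obtain i where "\<alpha> $ i < \<beta> $ i"
    using assms(2,3) by (metis less_eq_vec_def order_le_less vec_eq_iff)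
  then show "\<exists>i\<in>UNIV. a $ i * real (\<alpha> $ i) < a $ i * real (\<beta> $ i)"
    using assms(1) by (auto simp: pos_weights_def intro!: mult_strict_left_mono exI[of _ i])
qed simp

lemma finite_wt_le:
  assumes a: "a \<in> pos_weights"
  shows "finite {\<alpha>. wt a \<alpha> \<le> v}"
proof (rule finite_subset[OF _ finite_below])
  show "{\<alpha>. wt a \<alpha> \<le> v} \<subseteq> {\<alpha>. \<alpha> \<le> (\<chi> i. nat \<lceil>v / a $ i\<rceil>)}"
  proof clarsimp
    fix \<alpha> assume le: "wt a \<alpha> \<le> v"
    have "\<alpha> $ i \<le> nat \<lceil>v / a $ i\<rceil>" for i
    proof -
      have pos: "a $ j > 0" for j using a by (simp add: pos_weights_def)
      have "a $ i * real (\<alpha> $ i) \<le> wt a \<alpha>"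
        unfolding wt_def by (rule member_le_sum) (use less_imp_le[OF pos] in auto)
      then have "real (\<alpha> $ i) \<le> v / a $ i"
        using le pos[of i] by (simp add: field_simps)
      then show ?thesis by linarith
    qed
    then show "\<alpha> \<le> (\<chi> i. nat \<lceil>v / a $ i\<rceil>)" by (simp add: less_eq_vec_def)
  qed
qed

lemma Supp_eq_empty_iff: "Supp f = {} \<longleftrightarrow> f = 0"
  by (auto simp: Supp_def intro: mfps_eqI)

lemma nu_attained:
  assumes a: "a \<in> pos_weights" and f: "f \<noteq> 0"
  shows "\<exists>\<alpha>\<in>Supp f. wt a \<alpha> = nu f a"
    and "\<beta> \<in> Supp f \<Longrightarrow> nu f a \<le> wt a \<beta>"
proof -
  obtain \<gamma> where \<gamma>: "\<gamma> \<in> Supp f" using f Supp_eq_empty_iff by blast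
  have "finite {\<alpha>\<in>Supp f. wt a \<alpha> \<le> wt a \<gamma>}"
    using finite_wt_le[OF a] by (rule rev_finite_subset) auto
  from finite_imageI[OF this] have "finite (wt a ` {\<alpha>\<in>Supp f. wt a \<alpha> \<le> wt a \<gamma>})" .
  from finite_has_minimal2[OF this, of "wt a \<gamma>"] \<gamma>
  obtain \<mu> where \<mu>: "\<mu> \<in> Supp f" "wt a \<mu> \<le> wt a \<gamma>"
    "\<forall>\<alpha>\<in>Supp f. wt a \<alpha> \<le> wt a \<gamma> \<longrightarrow> wt a \<alpha> \<le> wt a \<mu> \<longrightarrow> wt a \<mu> = wt a \<alpha>"
    by auto
  have min: "wt a \<mu> \<le> wt a \<alpha>" if "\<alpha> \<in> Supp f" for \<alpha>
  proof (cases "wt a \<alpha> \<le> wt a \<mu>")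
    case True
    then have "wt a \<mu> = wt a \<alpha>"
      using \<mu>(2,3) that by (blast intro: order_trans)
    then show ?thesis by simp
  qed simp
  have "nu f a = wt a \<mu>"
    unfolding nu_def by (rule Least_equality) (use \<mu>(1) min in auto)
  then show "\<exists>\<alpha>\<in>Supp f. wt a \<alpha> = nu f a" "\<beta> \<in> Supp f \<Longrightarrow> nu f a \<le> wt a \<beta>"
    using \<mu>(1) min by auto
qed

lemma nu_eqI:
  assumes "\<mu> \<in> Supp f" "\<And>\<alpha>. \<alpha> \<in> Supp f \<Longrightarrow> wt a \<mu> \<le> wt a \<alpha>"
  shows "nu f a = wt a \<mu>"
  unfolding nu_def by (rule Least_equality) (use assms in auto)

lemma coeff_init_form: "coeff (init_form f a) \<alpha> = (if wt a \<alpha> = nu f a then coeff f \<alpha> else 0)"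
  by (simp add: init_form_def Supp_def)

lemma mem_Supp_init_form: "\<alpha> \<in> Supp (init_form f a) \<longleftrightarrow> \<alpha> \<in> Supp f \<and> wt a \<alpha> = nu f a"
  by (simp add: Supp_def coeff_init_form)

lemma init_form_eq_iff_Supp:
  "init_form f a = init_form f b \<longleftrightarrow> Supp (init_form f a) = Supp (init_form f b)"
proof
  assume eq: "Supp (init_form f a) = Supp (init_form f b)"
  have "coeff (init_form f a) \<alpha> = coeff (init_form f b) \<alpha>" for \<alpha>
  proof -
    have "\<alpha> \<in> Supp (init_form f a) \<longleftrightarrow> \<alpha> \<in> Supp (init_form f b)" by (simp add: eq)
    then show ?thesis by (auto simp: coeff_init_form mem_Supp_init_form Supp_def)
  qed
  then show "init_form f a = init_form f b" by (rule mfps_eqI)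
qed simp

text \<open>
  A smaller exponent in the support would have strictly smaller weight, all weights being positive.
\<close>

lemma Supp_init_form_subset_minimal_exps:
  assumes a: "a \<in> pos_weights" and f: "f \<noteq> 0"
  shows "Supp (init_form f a) \<subseteq> minimal_exps (Supp f)"
proof
  fix \<alpha> assume \<alpha>: "\<alpha> \<in> Supp (init_form f a)"
  have "\<beta> = \<alpha>" if "\<beta> \<in> Supp f" "\<beta> \<le> \<alpha>" for \<beta>
    using wt_strict_mono[OF a that(2)] nu_attained(2)[OF a f that(1)] \<alpha>
    by (force simp: mem_Supp_init_form)
  then show "\<alpha> \<in> minimal_exps (Supp f)" using \<alpha> by (auto simp: minimal_exps_def mem_Supp_init_form)
qed


section \<open>Cones of constancy of initial forms\<close>

definition exp_diff :: "nat ^ 'n::finite \<Rightarrow> nat ^ 'n \<Rightarrow> real ^ 'n" where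
  "exp_diff \<alpha> \<beta> = (\<chi> i. real (\<alpha> $ i) - real (\<beta> $ i))"

lemma rational_exp_diff: "rational_vec (exp_diff \<alpha> \<beta>)"
  by (simp add: rational_vec_def exp_diff_def)

lemma inner_exp_diff: "exp_diff \<alpha> \<beta> \<bullet> a = wt a \<alpha> - wt a \<beta>"
  by (simp add: exp_diff_def wt_def inner_vec_def algebra_simps sum_subtractf)

text \<open>
  An initial form is determined by its support, the set \<open>S\<close> of exponents of least weight, and \<open>S\<close>
  lies inside the finite set \<open>M\<close> of minimal exponents. Having initial support \<open>S\<close>
  means that the weights agree on \<open>S\<close> and are larger on \<open>M - S\<close>, since every other exponent lies above an
  element of \<open>M\<close> and so has no smaller weight. These are the linear conditions \<open>E\<close> and \<open>L\<close>, written
  relative to a reference exponent \<open>\<gamma> \<in> S\<close>.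
\<close>

lemma init_form_constancy_conditions:
  assumes a: "a \<in> pos_weights" and f: "f \<noteq> 0"
  shows "\<exists>E L. finite E \<and> finite L \<and> (\<forall>c\<in>E \<union> L. rational_vec c) \<and>
    (\<forall>b\<in>pos_weights. init_form f a = init_form f b \<longleftrightarrow>
        (\<forall>c\<in>E. c \<bullet> b = 0) \<and> (\<forall>c\<in>L. 0 < c \<bullet> b))"
proof -
  obtain \<gamma> where \<gamma>: "\<gamma> \<in> Supp f" "wt a \<gamma> = nu f a" using nu_attained(1)[OF a f] by blast
  define S where "S = Supp (init_form f a)"
  define M where "M = minimal_exps (Supp f)"
  have \<gamma>S: "\<gamma> \<in> S" using \<gamma> by (simp add: S_def mem_Supp_init_form)
  have SM: "S \<subseteq> M" unfolding S_def M_def using a f by (rule Supp_init_form_subset_minimal_exps)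
  have fin: "finite M" by (simp add: M_def finite_minimal_exps)
  define E where "E = (\<lambda>\<alpha>. exp_diff \<alpha> \<gamma>) ` S"
  define L where "L = (\<lambda>\<alpha>. exp_diff \<alpha> \<gamma>) ` (M - S)"
  have "init_form f a = init_form f b \<longleftrightarrow>
      (\<forall>\<alpha>\<in>S. wt b \<alpha> = wt b \<gamma>) \<and> (\<forall>\<alpha>\<in>M - S. wt b \<gamma> < wt b \<alpha>)"
    (is "_ \<longleftrightarrow> ?R") if b: "b \<in> pos_weights" for b
  proof
    assume "init_form f a = init_form f b"
    then have S: "S = Supp (init_form f b)" by (simp add: S_def)
    then have nu: "wt b \<alpha> = nu f b" if "\<alpha> \<in> S" for \<alpha> using that by (simp add: mem_Supp_init_form)
    have "nu f b < wt b \<alpha>" if "\<alpha> \<in> M - S" for \<alpha>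
    proof -
      have "\<alpha> \<in> Supp f" using that by (auto simp: M_def minimal_exps_def)
      moreover from this have "wt b \<alpha> \<noteq> nu f b" using that S by (simp add: mem_Supp_init_form)
      ultimately show ?thesis using nu_attained(2)[OF b f] by force
    qed
    then show ?R using nu \<gamma>S by auto
  next
    assume R: ?R
    have "wt b \<gamma> \<le> wt b \<beta>" if \<beta>: "\<beta> \<in> Supp f" for \<beta>
    proof -
      obtain \<alpha> where \<alpha>: "\<alpha> \<in> M" "\<alpha> \<le> \<beta>" using ex_minimal_exp_below[OF \<beta>] by (auto simp: M_def)
      have "wt b \<gamma> \<le> wt b \<alpha>" using R \<alpha>(1) by (cases "\<alpha> \<in> S") (auto intro: less_imp_le)
      also have "\<dots> \<le> wt b \<beta>" using wt_strict_mono[OF b \<alpha>(2)] by (cases "\<alpha> = \<beta>") auto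
      finally show ?thesis .
    qed
    then have nu: "nu f b = wt b \<gamma>" using \<gamma>(1) by (intro nu_eqI)
    have "S = Supp (init_form f b)"
    proof
      show "S \<subseteq> Supp (init_form f b)"
        using R SM by (auto simp: mem_Supp_init_form nu M_def minimal_exps_def)
      show "Supp (init_form f b) \<subseteq> S"
      proof
        fix \<alpha> assume \<alpha>: "\<alpha> \<in> Supp (init_form f b)"
        then have "\<alpha> \<in> M"
          using Supp_init_form_subset_minimal_exps[OF b f] by (auto simp: M_def)
        moreover have "wt b \<alpha> = wt b \<gamma>" using \<alpha> by (simp add: mem_Supp_init_form nu)
        moreover have "wt b \<alpha> \<noteq> wt b \<gamma>" if "\<alpha> \<in> M - S"
          using conjunct2[OF R, rule_format, OF that] by simp
        ultimately show "\<alpha> \<in> S" by blast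
      qed
    qed
    then show "init_form f a = init_form f b" by (simp add: init_form_eq_iff_Supp S_def)
  qed
  then have "\<forall>b\<in>pos_weights. init_form f a = init_form f b \<longleftrightarrow>
      (\<forall>c\<in>E. c \<bullet> b = 0) \<and> (\<forall>c\<in>L. 0 < c \<bullet> b)"
    by (simp add: E_def L_def inner_exp_diff)
  moreover have "finite E" "finite L" "\<forall>c\<in>E \<union> L. rational_vec c"
    using fin SM by (auto simp: E_def L_def rational_exp_diff intro: finite_subset)
  ultimately show ?thesis by blast
qed

lemma rational_polyhedral_coneI:
  assumes "finite E" "finite L" "\<forall>c\<in>E \<union> L. rational_vec c"
  shows "rational_polyhedral_cone
    {a \<in> pos_weights. (\<forall>c\<in>E. c \<bullet> a = 0) \<and> (\<forall>c\<in>L. 0 < c \<bullet> a)}" (is "rational_polyhedral_cone ?C")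
proof -
  have "convex ?C"
    unfolding convex_def
  proof (intro ballI allI impI)
    fix x y :: "real ^ 'a" and u v :: real
    assume xy: "x \<in> ?C" "y \<in> ?C" and uv: "0 \<le> u" "0 \<le> v" "u + v = 1"
    have pos: "0 < u * s + v * t" if "0 < s" "0 < t" for s t :: real
    proof (cases "u = 0")
      case False
      then have "0 < u * s" using uv that by simp
      moreover have "0 \<le> v * t" using uv that by simp
      ultimately show ?thesis by simp
    qed (use uv that in simp)
    show "u *\<^sub>R x + v *\<^sub>R y \<in> ?C"
      using xy by (auto simp: pos_weights_def inner_add_right intro!: pos)
  qed
  moreover have "\<forall>a\<in>?C. \<forall>t>0. t *\<^sub>R a \<in> ?C" by (auto simp: pos_weights_def)
  moreover have "\<exists>E' L' N. finite E' \<and> finite L' \<and> finite N \<and> (\<forall>c\<in>E' \<union> L' \<union> N. rational_vec c) \<and>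
      ?C = {a \<in> pos_weights. (\<forall>c\<in>E'. c \<bullet> a = 0) \<and> (\<forall>c\<in>L'. 0 < c \<bullet> a) \<and>
        (\<forall>c\<in>N. 0 \<le> c \<bullet> a)}"
    using assms by (intro exI[of _ E] exI[of _ L] exI[of _ "{}"]) simp
  moreover have "?C \<subseteq> pos_weights" by blast
  ultimately show ?thesis unfolding rational_polyhedral_cone_def by (intro conjI)
qed

lemma rational_polyhedral_cone_init_forms:
  fixes T :: "('k::field, 'n::finite) mfps set"
  assumes a: "a \<in> pos_weights" and T: "finite T" "0 \<notin> T"
  shows "rational_polyhedral_cone {b \<in> pos_weights. \<forall>g\<in>T. init_form g a = init_form g b}"
proof -
  define Q where "Q g p \<longleftrightarrow> finite (fst p) \<and> finite (snd p) \<and>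
      (\<forall>c\<in>fst p \<union> snd p. rational_vec c) \<and>
      (\<forall>b\<in>pos_weights. init_form g a = init_form g b \<longleftrightarrow>
        (\<forall>c\<in>fst p. c \<bullet> b = 0) \<and> (\<forall>c\<in>snd p. 0 < c \<bullet> b))" for g :: "('k, 'n) mfps" and p
  have "\<exists>p. Q g p" if "g \<in> T" for g
  proof -
    have "g \<noteq> 0" using that T(2) by auto
    from init_form_constancy_conditions[OF a this] show ?thesis
      unfolding Q_def split_paired_Ex fst_conv snd_conv .
  qed
  then have "\<forall>g\<in>T. \<exists>p. Q g p" by simp
  from bchoice[OF this] obtain p where p: "\<forall>g\<in>T. Q g (p g)" ..
  define E L where "E g = fst (p g)" and "L g = snd (p g)" for g
  have EL: "finite (E g) \<and> finite (L g)" "\<forall>c\<in>E g \<union> L g. rational_vec c"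
    "\<And>b. b \<in> pos_weights \<Longrightarrow> init_form g a = init_form g b \<longleftrightarrow>
        (\<forall>c\<in>E g. c \<bullet> b = 0) \<and> (\<forall>c\<in>L g. 0 < c \<bullet> b)" if "g \<in> T" for g
    using bspec[OF p that] unfolding Q_def E_def L_def by simp_all
  have "{b \<in> pos_weights. \<forall>g\<in>T. init_form g a = init_form g b} =
      {b \<in> pos_weights. (\<forall>c\<in>\<Union>(E ` T). c \<bullet> b = 0) \<and> (\<forall>c\<in>\<Union>(L ` T). 0 < c \<bullet> b)}"
    using EL(3) by auto
  moreover have "rational_polyhedral_cone \<dots>"
    by (rule rational_polyhedral_coneI) (use EL(1,2) T(1) in auto)
  ultimately show ?thesis by simp
qed


section \<open>Closed subalgebras\<close>

lemma mfps_subalgebra_hull: "mfps_subalgebra (mfps_subalgebra hull S)"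
proof (rule hull_in)
  fix \<B> :: "('a, 'b) mfps set set" assume B: "Ball \<B> mfps_subalgebra"
  have "range Const \<subseteq> B" "\<And>f g. f \<in> B \<Longrightarrow> g \<in> B \<Longrightarrow> f + g \<in> B \<and> f * g \<in> B"
    if "B \<in> \<B>" for B
    using bspec[OF B that] by (simp_all add: mfps_subalgebra_def)
  then show "mfps_subalgebra (\<Inter>\<B>)"
    unfolding mfps_subalgebra_def by (intro conjI ballI Inter_greatest InterI) (simp_all add: Inter_iff)
qed

lemma mpow_mult:
  assumes "f \<in> mpow N"
  shows "h * f \<in> mpow N"
  unfolding mpow_iff
proof (intro allI impI)
  fix \<gamma> :: "nat ^ 'b" assume \<gamma>: "(\<Sum>i\<in>UNIV. \<gamma> $ i) < N"
  have "coeff h \<alpha> * coeff f \<beta> = 0" if "(\<alpha>, \<beta>) \<in> antidiag \<gamma>" for \<alpha> \<beta>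
  proof -
    have "(\<Sum>i\<in>UNIV. \<beta> $ i) \<le> (\<Sum>i\<in>UNIV. \<gamma> $ i)"
      using that by (intro sum_mono) (auto simp: antidiag_def)
    then have "coeff f \<beta> = 0" using assms \<gamma> by (simp add: mpow_iff)
    then show ?thesis by simp
  qed
  then show "coeff (h * f) \<gamma> = 0" unfolding coeff_mult by (intro sum.neutral) auto
qed

lemma mpow_add: "f \<in> mpow N \<Longrightarrow> g \<in> mpow N \<Longrightarrow> f + g \<in> mpow N"
  by (simp add: mpow_iff)

lemma mfps_subalgebra_closure:
  assumes B: "mfps_subalgebra B"
  shows "mfps_subalgebra (closure B)"
  unfolding mfps_subalgebra_def
proof (intro conjI ballI)
  show "range Const \<subseteq> closure B" using B closure_subset[of B] unfolding mfps_subalgebra_def by blast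
next
  fix f g assume f: "f \<in> closure B" and g: "g \<in> closure B"
  have "\<exists>h\<in>B. h - (f + g) \<in> mpow N" "\<exists>h\<in>B. h - f * g \<in> mpow N" for N
  proof -
    obtain f' g' where f': "f' \<in> B" "f' - f \<in> mpow N" and g': "g' \<in> B" "g' - g \<in> mpow N"
      using f g unfolding closure_mfps_iff by blast
    have sum: "(f' + g') - (f + g) = (f' - f) + (g' - g)"
      and prod: "f' * g' - f * g = g * (f' - f) + f' * (g' - g)"
      by (simp_all add: algebra_simps)
    have "(f' + g') - (f + g) \<in> mpow N"
      unfolding sum using f'(2) g'(2) by (rule mpow_add)
    moreover have "f' * g' - f * g \<in> mpow N"
      unfolding prod using f'(2) g'(2) by (intro mpow_add mpow_mult)
    moreover have "f' + g' \<in> B" "f' * g' \<in> B" using B f'(1) g'(1) by (simp_all add: mfps_subalgebra_def)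
    ultimately show "\<exists>h\<in>B. h - (f + g) \<in> mpow N" "\<exists>h\<in>B. h - f * g \<in> mpow N" by blast+
  qed
  then show "f + g \<in> closure B" "f * g \<in> closure B" unfolding closure_mfps_iff by blast+
qed

definition closed_subalgebra :: "('k::field, 'n::finite) mfps set \<Rightarrow> bool" where
  "closed_subalgebra A \<longleftrightarrow> mfps_subalgebra A \<and> closed A"

lemma closed_subalgebra_powser_alg: "closed_subalgebra (powser_alg S)"
  unfolding closed_subalgebra_def powser_alg_def
  by (intro conjI mfps_subalgebra_closure mfps_subalgebra_hull closed_closure)

lemma coeff_Const_mult: "coeff (Const c * f) \<alpha> = c * coeff f \<alpha>"
  unfolding Const_def coeff_monom_mult by (simp add: vec_eq_iff)

context
  fixes A :: "('k::field, 'n::finite) mfps set"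
  assumes A: "mfps_subalgebra A"
begin

lemma subalgebra_add: "f \<in> A \<Longrightarrow> g \<in> A \<Longrightarrow> f + g \<in> A"
  and subalgebra_mult: "f \<in> A \<Longrightarrow> g \<in> A \<Longrightarrow> f * g \<in> A"
  and subalgebra_Const: "Const c \<in> A"
  using A by (simp_all add: mfps_subalgebra_def image_subset_iff)

lemma subalgebra_0: "0 \<in> A"
proof -
  have "Const 0 = (0 :: ('k, 'n) mfps)" by (rule mfps_eqI) (simp add: Const_def coeff_monom)
  then show ?thesis using subalgebra_Const[of 0] by simp
qed

lemma subalgebra_1: "1 \<in> A"
proof -
  have "Const 1 = (1 :: ('k, 'n) mfps)"
    by (rule mfps_eqI) (simp add: Const_def coeff_monom coeff_1)
  then show ?thesis using subalgebra_Const[of 1] by simp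
qed

lemma subalgebra_scale_diff: "f \<in> A \<Longrightarrow> g \<in> A \<Longrightarrow> f - Const c * g \<in> A"
proof -
  assume fg: "f \<in> A" "g \<in> A"
  have "f - Const c * g = f + Const (- c) * g" by (rule mfps_eqI) (simp add: coeff_Const_mult)
  also have "\<dots> \<in> A" using fg by (intro subalgebra_add subalgebra_mult subalgebra_Const)
  finally show "f - Const c * g \<in> A" .
qed

lemma subalgebra_diff: "f \<in> A \<Longrightarrow> g \<in> A \<Longrightarrow> f - g \<in> A"
proof -
  assume fg: "f \<in> A" "g \<in> A"
  have "f - g = f - Const 1 * g" by (rule mfps_eqI) (simp add: coeff_Const_mult)
  also have "\<dots> \<in> A" using fg by (rule subalgebra_scale_diff)
  finally show "f - g \<in> A" .
qed

lemma subalgebra_sum: "(\<And>x. x \<in> X \<Longrightarrow> g x \<in> A) \<Longrightarrow> (\<Sum>x\<in>X. g x) \<in> A"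
  by (induction X rule: infinite_finite_induct) (simp_all add: subalgebra_0 subalgebra_add)

end


section \<open>The local order attached to a weight\<close>

locale additive_well_order =
  fixes r :: "(nat ^ 'n::finite) rel"
  assumes wo: "well_order_on UNIV r"
    and compat: "(\<alpha>, \<beta>) \<in> r \<Longrightarrow> (\<alpha> + \<gamma>, \<beta> + \<gamma>) \<in> r"
begin

lemma r_wf: "wf (r - Id)"
  using wo by (simp add: well_order_on_def)

lemma r_refl: "(\<alpha>, \<alpha>) \<in> r"
  using wo by (simp add: order_on_defs refl_on_def)

lemma r_trans: "(\<alpha>, \<beta>) \<in> r \<Longrightarrow> (\<beta>, \<gamma>) \<in> r \<Longrightarrow> (\<alpha>, \<gamma>) \<in> r"
  using wo unfolding order_on_defs by (blast dest: transD)

lemma r_antisym: "(\<alpha>, \<beta>) \<in> r \<Longrightarrow> (\<beta>, \<alpha>) \<in> r \<Longrightarrow> \<alpha> = \<beta>"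
  using wo unfolding order_on_defs by (blast dest: antisymD)

lemma r_total: "(\<alpha>, \<beta>) \<in> r \<or> (\<beta>, \<alpha>) \<in> r"
  using wo r_refl by (cases "\<alpha> = \<beta>") (auto simp: order_on_defs total_on_def)

text \<open>
  The order in which division treats exponents: \<open>leads a \<mu> \<alpha>\<close> says that \<open>\<mu>\<close> comes before or equals \<open>\<alpha>\<close>
  when exponents are sorted by increasing weight and, within one weight, decreasingly for \<open>r\<close>. The leading
  exponent of a series is the first element of its support, although \<open>r\<close> itself asks for a maximum.
\<close>

definition leads :: "real ^ 'n \<Rightarrow> nat ^ 'n \<Rightarrow> nat ^ 'n \<Rightarrow> bool" where
  "leads a \<mu> \<alpha> \<longleftrightarrow> wt a \<mu> < wt a \<alpha> \<or> wt a \<mu> = wt a \<alpha> \<and> (\<alpha>, \<mu>) \<in> r"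

lemma leads_refl: "leads a \<alpha> \<alpha>"
  by (simp add: leads_def r_refl)

lemma leads_trans: "leads a \<alpha> \<beta> \<Longrightarrow> leads a \<beta> \<gamma> \<Longrightarrow> leads a \<alpha> \<gamma>"
  by (auto simp: leads_def intro: r_trans)

lemma leads_antisym: "leads a \<alpha> \<beta> \<Longrightarrow> leads a \<beta> \<alpha> \<Longrightarrow> \<alpha> = \<beta>"
  by (auto simp: leads_def intro: r_antisym)

lemma leads_total: "leads a \<alpha> \<beta> \<or> leads a \<beta> \<alpha>"
  using r_total[of \<alpha> \<beta>] by (auto simp: leads_def)

lemma leads_wt: "leads a \<alpha> \<beta> \<Longrightarrow> wt a \<alpha> \<le> wt a \<beta>"
  by (auto simp: leads_def)

lemma leads_add: "leads a \<alpha> \<beta> \<Longrightarrow> leads a (\<alpha> + \<gamma>) (\<beta> + \<gamma>)"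
  by (auto simp: leads_def wt_add compat)

lemma leads_add2: "leads a \<alpha> \<beta> \<Longrightarrow> leads a \<gamma> \<delta> \<Longrightarrow> leads a (\<alpha> + \<gamma>) (\<beta> + \<delta>)"
  by (metis leads_add leads_trans add.commute)

lemma finite_leads: "a \<in> pos_weights \<Longrightarrow> finite {\<mu>. leads a \<mu> \<alpha>}"
  using finite_wt_le by (rule rev_finite_subset) (auto dest: leads_wt)

lemma wf_leads:
  assumes "a \<in> pos_weights"
  shows "wf {(\<mu>, \<alpha>). leads a \<mu> \<alpha> \<and> \<mu> \<noteq> \<alpha>}"
proof (rule wf_finite_segments)
  show "trans {(\<mu>, \<alpha>). leads a \<mu> \<alpha> \<and> \<mu> \<noteq> \<alpha>}"
    by (auto intro!: transI intro: leads_trans dest: leads_antisym)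
  fix \<alpha>
  show "finite {\<mu>. (\<mu>, \<alpha>) \<in> {(\<mu>, \<alpha>). leads a \<mu> \<alpha> \<and> \<mu> \<noteq> \<alpha>}}"
    by (rule finite_subset[OF _ finite_leads[OF assms]]) auto
qed (simp add: irrefl_def)

lemma lead_exp_eqI:
  assumes \<mu>: "\<mu> \<in> Supp f" "\<And>\<alpha>. \<alpha> \<in> Supp f \<Longrightarrow> leads a \<mu> \<alpha>"
  shows "lead_exp r f a = \<mu>"
proof -
  have nu: "nu f a = wt a \<mu>" using assms by (intro nu_eqI leads_wt)
  have max: "(\<alpha>, \<mu>) \<in> r" if "\<alpha> \<in> Supp (init_form f a)" for \<alpha>
  proof -
    have "\<alpha> \<in> Supp f" "wt a \<alpha> = wt a \<mu>" using that by (simp_all add: mem_Supp_init_form nu)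
    then show ?thesis using \<mu>(2)[of \<alpha>] by (simp add: leads_def)
  qed
  have mem: "\<mu> \<in> Supp (init_form f a)" using \<mu>(1) by (simp add: mem_Supp_init_form nu)
  show ?thesis
    unfolding lead_exp_def max_wrt_def
    by (rule the_equality) (use max mem r_antisym in blast)+
qed

context
  fixes a :: "real ^ 'n" and f :: "('k::field, 'n) mfps"
  assumes a: "a \<in> pos_weights" and f: "f \<noteq> 0"
begin

lemma lead_exp_in_Supp: "lead_exp r f a \<in> Supp f"
  and lead_exp_leads: "\<alpha> \<in> Supp f \<Longrightarrow> leads a (lead_exp r f a) \<alpha>"
proof -
  obtain \<gamma> where "\<gamma> \<in> Supp f" using f Supp_eq_empty_iff by blast
  from wfE_min[OF wf_leads[OF a] this] obtain \<mu> where
    \<mu>: "\<mu> \<in> Supp f" "\<And>\<beta>. (\<beta>, \<mu>) \<in> {(\<mu>, \<alpha>). leads a \<mu> \<alpha> \<and> \<mu> \<noteq> \<alpha>} \<Longrightarrow> \<beta> \<notin> Supp f" by blast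
  have min: "leads a \<mu> \<alpha>" if "\<alpha> \<in> Supp f" for \<alpha>
    using \<mu>(2)[of \<alpha>] that leads_total[of a \<mu> \<alpha>] leads_refl by auto
  have "lead_exp r f a = \<mu>" using \<mu>(1) min by (rule lead_exp_eqI)
  then show "lead_exp r f a \<in> Supp f" "\<alpha> \<in> Supp f \<Longrightarrow> leads a (lead_exp r f a) \<alpha>"
    using \<mu>(1) min by simp_all
qed

lemma nu_eq_wt_lead_exp: "nu f a = wt a (lead_exp r f a)"
  using lead_exp_in_Supp lead_exp_leads by (intro nu_eqI leads_wt)

end

text \<open>
  Addition respects the order, so two exponents of the supports that are not both leading have a sum
  that comes strictly later; the coefficient at the sum of the leading exponents is therefore a
  single product of nonzero coefficients.
\<close>

lemma sum_lead_exps_leads_product: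
  fixes f g :: "('k::field, 'n) mfps"
  assumes a: "a \<in> pos_weights" and f: "f \<noteq> 0" and g: "g \<noteq> 0"
  defines "\<mu> \<equiv> lead_exp r f a" and "\<eta> \<equiv> lead_exp r g a"
  shows "\<mu> + \<eta> \<in> Supp (f * g)" and "\<delta> \<in> Supp (f * g) \<Longrightarrow> leads a (\<mu> + \<eta>) \<delta>"
proof -
  have zero: "coeff f \<alpha> * coeff g \<beta> = 0"
    if "(\<alpha>, \<beta>) \<in> antidiag (\<mu> + \<eta>)" "(\<alpha>, \<beta>) \<noteq> (\<mu>, \<eta>)" for \<alpha> \<beta>
  proof (rule ccontr)
    assume "coeff f \<alpha> * coeff g \<beta> \<noteq> 0"
    then have "leads a \<mu> \<alpha>" "leads a \<eta> \<beta>"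
      using lead_exp_leads[OF a f] lead_exp_leads[OF a g] by (auto simp: Supp_def \<mu>_def \<eta>_def)
    moreover have sum: "\<alpha> + \<beta> = \<mu> + \<eta>" using that(1) by (simp add: antidiag_def)
    ultimately have "leads a (\<mu> + \<beta>) (\<mu> + \<eta>)" "leads a (\<mu> + \<eta>) (\<mu> + \<beta>)"
      using leads_add[of a \<mu> \<alpha> \<beta>] leads_add2[OF leads_refl, of a \<eta> \<beta> \<mu>] by simp_all
    then have "\<mu> + \<beta> = \<mu> + \<eta>" by (rule leads_antisym)
    then show False using sum that(2) by simp
  qed
  have "coeff (f * g) (\<mu> + \<eta>) =
      (\<Sum>p\<in>antidiag (\<mu> + \<eta>). if p = (\<mu>, \<eta>) then coeff f \<mu> * coeff g \<eta> else 0)"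
    unfolding coeff_mult
  proof (rule sum.cong)
    fix p assume "p \<in> antidiag (\<mu> + \<eta>)"
    then show "(case p of (\<alpha>, \<beta>) \<Rightarrow> coeff f \<alpha> * coeff g \<beta>) =
        (if p = (\<mu>, \<eta>) then coeff f \<mu> * coeff g \<eta> else 0)"
      using zero[of "fst p" "snd p"] by (cases "p = (\<mu>, \<eta>)") (simp_all add: case_prod_unfold)
  qed simp
  also have "\<dots> = coeff f \<mu> * coeff g \<eta>"
    by (subst sum.delta, rule finite_antidiag) (simp add: antidiag_def)
  also have "\<dots> \<noteq> 0"
    using lead_exp_in_Supp[OF a f] lead_exp_in_Supp[OF a g] by (simp add: Supp_def \<mu>_def \<eta>_def)
  finally show "\<mu> + \<eta> \<in> Supp (f * g)" by (simp add: Supp_def)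
  assume "\<delta> \<in> Supp (f * g)"
  then have "(\<Sum>p\<in>antidiag \<delta>. coeff f (fst p) * coeff g (snd p)) \<noteq> 0"
    by (simp add: Supp_def coeff_mult case_prod_unfold)
  then obtain p where p: "p \<in> antidiag \<delta>" "coeff f (fst p) * coeff g (snd p) \<noteq> 0"
    using sum.not_neutral_contains_not_neutral by blast
  have "leads a \<mu> (fst p)" "leads a \<eta> (snd p)"
    using p(2) lead_exp_leads[OF a f] lead_exp_leads[OF a g] by (auto simp: Supp_def \<mu>_def \<eta>_def)
  then have "leads a (\<mu> + \<eta>) (fst p + snd p)" by (rule leads_add2)
  then show "leads a (\<mu> + \<eta>) \<delta>" using p(1) by (simp add: antidiag_def case_prod_unfold)
qed

context
  fixes a :: "real ^ 'n" and f g :: "('k::field, 'n) mfps"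
  assumes a: "a \<in> pos_weights" and f: "f \<noteq> 0" and g: "g \<noteq> 0"
begin

lemma mult_nonzero: "f * g \<noteq> 0"
  using sum_lead_exps_leads_product(1)[OF a f g] by (auto simp: Supp_def)

lemma lead_exp_mult: "lead_exp r (f * g) a = lead_exp r f a + lead_exp r g a"
  using sum_lead_exps_leads_product[OF a f g] by (intro lead_exp_eqI)

lemma init_form_mult: "init_form (f * g) a = init_form f a * init_form g a"
proof (rule mfps_eqI)
  fix \<delta>
  have nu: "nu (f * g) a = nu f a + nu g a"
    by (simp add: nu_eq_wt_lead_exp[OF a] mult_nonzero f g lead_exp_mult wt_add)
  have "(if wt a \<delta> = nu (f * g) a then coeff f \<alpha> * coeff g \<beta> else 0) =
      coeff (init_form f a) \<alpha> * coeff (init_form g a) \<beta>" if "(\<alpha>, \<beta>) \<in> antidiag \<delta>" for \<alpha> \<beta>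
  proof (cases "coeff f \<alpha> = 0 \<or> coeff g \<beta> = 0")
    case True
    then show ?thesis by (auto simp: coeff_init_form)
  next
    case False
    then have "nu f a \<le> wt a \<alpha>" "nu g a \<le> wt a \<beta>"
      using nu_attained(2)[OF a f] nu_attained(2)[OF a g] by (auto simp: Supp_def)
    moreover have "wt a \<delta> = wt a \<alpha> + wt a \<beta>" using that by (auto simp: antidiag_def wt_add)
    ultimately show ?thesis by (auto simp: coeff_init_form nu)
  qed
  then have "(\<Sum>p\<in>antidiag \<delta>. if wt a \<delta> = nu (f * g) a then coeff f (fst p) * coeff g (snd p) else 0) =
      (\<Sum>p\<in>antidiag \<delta>. coeff (init_form f a) (fst p) * coeff (init_form g a) (snd p))"
    by (intro sum.cong) auto
  then show "coeff (init_form (f * g) a) \<delta> = coeff (init_form f a * init_form g a) \<delta>"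
    by (auto simp: coeff_init_form[of "f * g"] coeff_mult case_prod_unfold split: if_splits)
qed

end


section \<open>Division by a closed subalgebra\<close>

text \<open>
  Pick for each \<open>h \<in> H\<close> a series \<open>g h\<close> in \<open>A\<close> with leading exponent \<open>h\<close> and leading coefficient \<open>1\<close>. The
  conditions that \<open>q = (\<Sum>h\<in>H. c h * g h)\<close> agrees with \<open>f\<close> on \<open>H\<close> form a triangular system for the
  coefficients \<open>c h\<close>. If the leading exponent of \<open>f\<close> lies outside \<open>H\<close>, every \<open>h\<close> before it gets
  coefficient \<open>0\<close>, so subtracting \<open>q\<close> leaves the leading term of \<open>f\<close> in place.
\<close>

lemma division_by_closed_subalgebra:
  fixes A :: "('k::field, 'n) mfps set"
  assumes a: "a \<in> pos_weights" and A: "closed_subalgebra A" and H: "H \<subseteq> exp_set r A a"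
  shows "\<exists>q\<in>A. Supp (f - q) \<inter> H = {} \<and>
    (f \<noteq> 0 \<longrightarrow> lead_exp r f a \<notin> H \<longrightarrow> f - q \<noteq> 0)"
proof -
  have subA: "mfps_subalgebra A" and clA: "closed A" using A by (simp_all add: closed_subalgebra_def)
  have "\<exists>g\<in>A. coeff g h = 1 \<and> (\<forall>\<alpha>\<in>Supp g. leads a h \<alpha>)" if h: "h \<in> H" for h
  proof -
    obtain g where g: "g \<in> A" "g \<noteq> 0" "lead_exp r g a = h"
      using h H unfolding exp_set_def by blast
    have c: "coeff g h \<noteq> 0" using lead_exp_in_Supp[OF a g(2)] g(3) by (simp add: Supp_def)
    have "Const (inverse (coeff g h)) * g \<in> A"
      using subA g(1) by (intro subalgebra_mult subalgebra_Const)
    moreover have "coeff (Const (inverse (coeff g h)) * g) h = 1" using c by (simp add: coeff_Const_mult)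
    moreover have "leads a h \<alpha>" if "\<alpha> \<in> Supp (Const (inverse (coeff g h)) * g)" for \<alpha>
      using that lead_exp_leads[OF a g(2)] g(3) by (simp add: Supp_def coeff_Const_mult)
    ultimately show ?thesis by blast
  qed
  then have "\<forall>h\<in>H. \<exists>g. g \<in> A \<and> coeff g h = 1 \<and> (\<forall>\<alpha>\<in>Supp g. leads a h \<alpha>)" by blast
  from bchoice[OF this] obtain g where
    g: "\<And>h. h \<in> H \<Longrightarrow> g h \<in> A" "\<And>h. h \<in> H \<Longrightarrow> coeff (g h) h = 1"
    and g_leads: "\<And>h \<alpha>. h \<in> H \<Longrightarrow> \<not> leads a h \<alpha> \<Longrightarrow> coeff (g h) \<alpha> = 0"
    by (auto simp: Supp_def)
  define below where "below \<alpha> = {h\<in>H. leads a h \<alpha>}" for \<alpha>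
  have fin: "finite (below \<alpha>)" for \<alpha>
    unfolding below_def using finite_leads[OF a] by (rule rev_finite_subset) auto
  have "\<exists>c. \<forall>h. c h = coeff f h - (\<Sum>h'\<in>below h - {h}. c h' * coeff (g h') h)"
  proof (rule dependent_wf_choice[OF wf_leads[OF a]])
    fix c c' :: "nat ^ 'n \<Rightarrow> 'k" and h z
    assume eq: "\<And>h'. (h', h) \<in> {(\<mu>, \<alpha>). leads a \<mu> \<alpha> \<and> \<mu> \<noteq> \<alpha>} \<Longrightarrow> c h' = c' h'"
    have "(\<Sum>h'\<in>below h - {h}. c h' * coeff (g h') h) = (\<Sum>h'\<in>below h - {h}. c' h' * coeff (g h') h)"
      by (rule sum.cong) (use eq in \<open>auto simp: below_def\<close>)
    then show "(z = coeff f h - (\<Sum>h'\<in>below h - {h}. c h' * coeff (g h') h)) =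
        (z = coeff f h - (\<Sum>h'\<in>below h - {h}. c' h' * coeff (g h') h))" by simp
  qed blast
  then obtain c where c: "\<And>h. c h = coeff f h - (\<Sum>h'\<in>below h - {h}. c h' * coeff (g h') h)"
    by blast
  define q where "q = Mfps (\<lambda>\<alpha>. \<Sum>h\<in>below \<alpha>. c h * coeff (g h) \<alpha>)"
  have "q \<in> closure A"
    unfolding closure_mfps_iff
  proof
    fix N
    \<comment> \<open>Only finitely many summands are visible in degrees below \<open>N\<close>.\<close>
    define D where "D = (\<Union>\<alpha>\<in>{\<alpha>. (\<Sum>i\<in>UNIV. \<alpha> $ i) < N}. below \<alpha>)"
    have "{\<alpha> :: nat ^ 'n. (\<Sum>i\<in>UNIV. \<alpha> $ i) < N} \<subseteq> {\<alpha>. \<alpha> \<le> (\<chi> i. N)}"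
    proof
      fix \<alpha> :: "nat ^ 'n" assume "\<alpha> \<in> {\<alpha>. (\<Sum>i\<in>UNIV. \<alpha> $ i) < N}"
      moreover have "\<alpha> $ i \<le> (\<Sum>i\<in>UNIV. \<alpha> $ i)" for i by (rule member_le_sum) auto
      ultimately have "\<alpha> $ i \<le> N" for i by (meson less_imp_le mem_Collect_eq order_trans)
      then show "\<alpha> \<in> {\<alpha>. \<alpha> \<le> (\<chi> i. N)}" by (simp add: less_eq_vec_def)
    qed
    then have "finite {\<alpha> :: nat ^ 'n. (\<Sum>i\<in>UNIV. \<alpha> $ i) < N}" using finite_below finite_subset by blast
    then have finD: "finite D" unfolding D_def using fin by blast
    define p where "p = (\<Sum>h\<in>D. Const (c h) * g h)"
    have "p \<in> A"
      unfolding p_def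
    proof (rule subalgebra_sum[OF subA])
      fix h assume "h \<in> D"
      then have "h \<in> H" by (auto simp: D_def below_def)
      then show "Const (c h) * g h \<in> A" using subA g(1) by (intro subalgebra_mult subalgebra_Const)
    qed
    moreover have "coeff p \<alpha> = coeff q \<alpha>" if \<alpha>: "(\<Sum>i\<in>UNIV. \<alpha> $ i) < N" for \<alpha>
    proof -
      have "coeff p \<alpha> = (\<Sum>h\<in>D. c h * coeff (g h) \<alpha>)"
        by (simp add: p_def coeff_sum coeff_Const_mult)
      also have "\<dots> = (\<Sum>h\<in>below \<alpha>. c h * coeff (g h) \<alpha>)"
      proof (rule sum.mono_neutral_right[OF finD])
        show "below \<alpha> \<subseteq> D" using \<alpha> by (auto simp: D_def)
        show "\<forall>h\<in>D - below \<alpha>. c h * coeff (g h) \<alpha> = 0"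
          using g_leads by (auto simp: D_def below_def)
      qed
      finally show ?thesis by (simp add: q_def)
    qed
    ultimately show "\<exists>p\<in>A. p - q \<in> mpow N" by (auto simp: mpow_iff intro!: bexI[of _ p])
  qed
  then have "q \<in> A" using clA by simp
  moreover have "Supp (f - q) \<inter> H = {}"
  proof -
    have "coeff (f - q) h = 0" if h: "h \<in> H" for h
    proof -
      have "h \<in> below h" using h by (simp add: below_def leads_refl)
      then have "coeff q h = c h * coeff (g h) h + (\<Sum>h'\<in>below h - {h}. c h' * coeff (g h') h)"
        by (simp add: q_def sum.remove[OF fin])
      also have "\<dots> = coeff f h" using g(2)[OF h] c[of h] by simp
      finally show ?thesis by simp
    qed
    then show ?thesis by (auto simp: Supp_def)
  qed
  moreover have "f - q \<noteq> 0" if f: "f \<noteq> 0" "lead_exp r f a \<notin> H"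
  proof -
    define \<mu> where "\<mu> = lead_exp r f a"
    \<comment> \<open>By recursion, \<open>c h\<close> only depends on coefficients of \<open>f\<close> at exponents up to \<open>h\<close>.\<close>
    have "h \<in> below \<mu> \<longrightarrow> c h = 0" for h
    proof (induction h rule: wf_induct[OF wf_leads[OF a]])
      case (1 h)
      show ?case
      proof
        assume h: "h \<in> below \<mu>"
        have "h \<noteq> \<mu>" using h f(2) by (auto simp: below_def \<mu>_def)
        moreover have "leads a h \<mu>" using h by (simp add: below_def)
        ultimately have "\<not> leads a \<mu> h" using leads_antisym by blast
        then have "coeff f h = 0"
          using lead_exp_leads[OF a f(1), of h] by (auto simp: Supp_def \<mu>_def)
        moreover have "c h' = 0" if h': "h' \<in> below h - {h}" for h'
        proof -
          have "h' \<in> below \<mu>"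
            using h h' leads_trans[of a h' h \<mu>] by (simp add: below_def)
          moreover have "(h', h) \<in> {(\<mu>, \<alpha>). leads a \<mu> \<alpha> \<and> \<mu> \<noteq> \<alpha>}"
            using h' by (auto simp: below_def)
          ultimately show ?thesis using 1 by blast
        qed
        ultimately show "c h = 0" by (subst c) simp
      qed
    qed
    then have "coeff q \<mu> = 0" by (simp add: q_def)
    then have "coeff (f - q) \<mu> \<noteq> 0"
      using lead_exp_in_Supp[OF a f(1)] by (simp add: Supp_def \<mu>_def)
    then show ?thesis by auto
  qed
  ultimately show ?thesis by blast
qed

text \<open>
  Suppose that \<open>f\<close> in \<open>A\<close> has a \<open>b\<close>-leading exponent outside \<open>exp_set r A a\<close>. Dividing with respect to
  \<open>b\<close> leaves a nonzero remainder in \<open>A\<close> whose support misses \<open>exp_set r A a\<close>; but the \<open>a\<close>-leading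
  exponent of this remainder lies in both sets.
\<close>

lemma exp_set_no_proper_inclusion:
  fixes A :: "('k::field, 'n) mfps set"
  assumes a: "a \<in> pos_weights" and b: "b \<in> pos_weights" and A: "closed_subalgebra A"
    and sub: "exp_set r A a \<subseteq> exp_set r A b"
  shows "exp_set r A b = exp_set r A a"
proof (rule ccontr)
  assume "exp_set r A b \<noteq> exp_set r A a"
  then obtain f where f: "f \<in> A" "f \<noteq> 0" "lead_exp r f b \<notin> exp_set r A a"
    using sub unfolding exp_set_def by blast
  obtain q where q: "q \<in> A" "Supp (f - q) \<inter> exp_set r A a = {}" "f - q \<noteq> 0"
    using division_by_closed_subalgebra[OF b A sub, of f] f by blast
  have "f - q \<in> A" using A f(1) q(1) by (simp add: closed_subalgebra_def subalgebra_diff)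
  then have "lead_exp r (f - q) a \<in> exp_set r A a" using q(3) by (auto simp: exp_set_def)
  then show False using lead_exp_in_Supp[OF a q(3)] q(2) by blast
qed


section \<open>Reduced bases\<close>

text \<open>
  With \<open>B = UNIV\<close> this says that the exponents of \<open>A\<close> form a monoid. With \<open>B\<close> generated by the initial
  forms of a basis it shows that every exponent of \<open>A\<close> is attained by a series whose initial form
  is a polynomial in those of the basis.
\<close>

lemma add_submonoid_exp_set:
  fixes A :: "('k::field, 'n) mfps set"
  assumes a: "a \<in> pos_weights" and A: "mfps_subalgebra A"
    and B: "mfps_subalgebra B"
  shows "add_submonoid {lead_exp r f a | f. f \<in> A \<and> f \<noteq> 0 \<and> init_form f a \<in> B}"
  unfolding add_submonoid_def
proof (intro conjI ballI)
  have S: "Supp (1 :: ('k, 'n) mfps) = {0}" by (auto simp: Supp_def coeff_1)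
  have lead: "lead_exp r (1 :: ('k, 'n) mfps) a = 0" by (rule lead_exp_eqI) (simp_all add: S leads_refl)
  have "nu (1 :: ('k, 'n) mfps) a = wt a 0" by (rule nu_eqI) (simp_all add: S)
  then have "init_form (1 :: ('k, 'n) mfps) a = 1"
    by (intro mfps_eqI) (simp add: coeff_init_form coeff_1)
  then show "0 \<in> {lead_exp r f a | f. f \<in> A \<and> f \<noteq> 0 \<and> init_form f a \<in> B}"
    using lead subalgebra_1[OF A] subalgebra_1[OF B] by (auto intro!: exI[of _ 1])
next
  fix \<alpha> \<beta>
  assume "\<alpha> \<in> {lead_exp r f a | f. f \<in> A \<and> f \<noteq> 0 \<and> init_form f a \<in> B}"
    and "\<beta> \<in> {lead_exp r f a | f. f \<in> A \<and> f \<noteq> 0 \<and> init_form f a \<in> B}"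
  then obtain f g where f: "f \<in> A" "f \<noteq> 0" "init_form f a \<in> B" "\<alpha> = lead_exp r f a"
    and g: "g \<in> A" "g \<noteq> 0" "init_form g a \<in> B" "\<beta> = lead_exp r g a" by blast
  have "f * g \<in> A" "init_form (f * g) a \<in> B"
    using f g A B by (simp_all add: subalgebra_mult init_form_mult[OF a])
  moreover have "f * g \<noteq> 0" "\<alpha> + \<beta> = lead_exp r (f * g) a"
    using f g by (simp_all add: mult_nonzero[OF a] lead_exp_mult[OF a])
  ultimately show "\<alpha> + \<beta> \<in> {lead_exp r f a | f. f \<in> A \<and> f \<noteq> 0 \<and> init_form f a \<in> B}" by blast
qed

lemma add_submonoid_hull_subset_exp_set:
  fixes A :: "('k::field, 'n) mfps set"
  assumes a: "a \<in> pos_weights" and A: "mfps_subalgebra A" and T: "T \<subseteq> A - {0}"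
  shows "add_submonoid hull ((\<lambda>g. lead_exp r g a) ` T) \<subseteq> exp_set r A a"
proof (rule hull_minimal)
  have "mfps_subalgebra (UNIV :: ('k, 'n) mfps set)" by (simp add: mfps_subalgebra_def)
  from add_submonoid_exp_set[OF a A this] show "add_submonoid (exp_set r A a)"
    by (simp add: exp_set_def)
qed (use T in \<open>auto simp: exp_set_def\<close>)

text \<open>
  For a generator \<open>\<gamma>\<close> of the exponents, dividing the monomial with exponent \<open>\<gamma>\<close> by \<open>A\<close> produces
  \<open>q\<close> in \<open>A\<close> that differs from this monomial only outside \<open>exp_set r A a\<close>. The choice of \<open>q\<close> refers to
  \<open>a\<close>, but the property that its support meets the set of exponents only in \<open>\<gamma>\<close> does not, which is why the
  same \<open>T\<close> works for every \<open>b\<close> with the same exponents.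
\<close>

lemma ex_reduced_basis:
  fixes A :: "('k::field, 'n) mfps set"
  assumes a: "a \<in> pos_weights" and A: "closed_subalgebra A"
    and fg: "fin_gen_semigroup (exp_set r A a)"
  shows "\<exists>T. finite T \<and> T \<subseteq> A - {0} \<and>
    (\<forall>b\<in>pos_weights. exp_set r A b = exp_set r A a \<longrightarrow>
      exp_set r A b = add_submonoid hull ((\<lambda>g. lead_exp r g b) ` T))"
proof -
  define H where "H = exp_set r A a"
  obtain G where G: "finite G" "H = add_submonoid hull G"
    using fg by (auto simp: fin_gen_semigroup_def H_def)
  have "\<exists>q. q \<in> A \<and> Supp q \<inter> H = {\<gamma>}" if \<gamma>: "\<gamma> \<in> G" for \<gamma>
  proof -
    have \<gamma>H: "\<gamma> \<in> H" unfolding G(2) using \<gamma> by (rule hull_inc)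
    obtain q where q: "q \<in> A" "Supp (monom 1 \<gamma> - q) \<inter> H = {}"
      using division_by_closed_subalgebra[OF a A order_refl, of "monom 1 \<gamma>"] by (auto simp: H_def)
    have "coeff q \<alpha> = (if \<alpha> = \<gamma> then 1 else 0)" if "\<alpha> \<in> H" for \<alpha>
    proof -
      have "\<alpha> \<notin> Supp (monom 1 \<gamma> - q)" using q(2) that by blast
      then show ?thesis by (auto simp: Supp_def coeff_monom)
    qed
    then have "Supp q \<inter> H = {\<gamma>}" using \<gamma>H by (auto simp: Supp_def split: if_splits)
    then show ?thesis using q(1) by blast
  qed
  then have "\<forall>\<gamma>\<in>G. \<exists>q. q \<in> A \<and> Supp q \<inter> H = {\<gamma>}" by blast
  from bchoice[OF this] obtain q where
    q: "\<And>\<gamma>. \<gamma> \<in> G \<Longrightarrow> q \<gamma> \<in> A" "\<And>\<gamma>. \<gamma> \<in> G \<Longrightarrow> Supp (q \<gamma>) \<inter> H = {\<gamma>}" by blast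
  have nz: "q \<gamma> \<noteq> 0" if "\<gamma> \<in> G" for \<gamma>
    using q(2)[OF that] Supp_eq_empty_iff[of "q \<gamma>"] by auto
  have "exp_set r A b = add_submonoid hull ((\<lambda>g. lead_exp r g b) ` (q ` G))"
    if b: "b \<in> pos_weights" and Hb: "exp_set r A b = H" for b
  proof -
    have "lead_exp r (q \<gamma>) b = \<gamma>" if \<gamma>: "\<gamma> \<in> G" for \<gamma>
    proof -
      have "lead_exp r (q \<gamma>) b \<in> exp_set r A b" using q(1)[OF \<gamma>] nz[OF \<gamma>] by (auto simp: exp_set_def)
      then have "lead_exp r (q \<gamma>) b \<in> Supp (q \<gamma>) \<inter> H"
        using lead_exp_in_Supp[OF b nz[OF \<gamma>]] Hb by simp
      then show ?thesis using q(2)[OF \<gamma>] by simp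
    qed
    then have "(\<lambda>g. lead_exp r g b) ` (q ` G) = G" by (simp add: image_image)
    then show ?thesis using Hb G(2) by simp
  qed
  moreover have "finite (q ` G)" "q ` G \<subseteq> A - {0}" using G(1) q(1) nz by auto
  ultimately show ?thesis unfolding H_def by blast
qed

lemma exp_set_eq_if_init_forms_eq:
  fixes A :: "('k::field, 'n) mfps set"
  assumes a: "a \<in> pos_weights" and b: "b \<in> pos_weights" and A: "closed_subalgebra A"
    and T: "T \<subseteq> A - {0}" "exp_set r A a = add_submonoid hull ((\<lambda>g. lead_exp r g a) ` T)"
    and eq: "\<forall>g\<in>T. init_form g a = init_form g b"
  shows "exp_set r A b = exp_set r A a"
proof (rule exp_set_no_proper_inclusion[OF a b A])
  have "(\<lambda>g. lead_exp r g a) ` T = (\<lambda>g. lead_exp r g b) ` T"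
    using eq by (intro image_cong) (simp_all add: lead_exp_def)
  then show "exp_set r A a \<subseteq> exp_set r A b"
    using add_submonoid_hull_subset_exp_set[OF b _ T(1)] A T(2) by (simp add: closed_subalgebra_def)
qed

text \<open>
  Initial forms can be reduced in finitely many steps, without taking limits: subtracting a multiple of a
  series with the same leading exponent either raises the least weight or leaves nothing, and then the two
  initial forms are proportional, or it lowers the leading exponent for the well order \<open>r\<close>.
\<close>

lemma init_form_in_hull:
  fixes A :: "('k::field, 'n) mfps set"
  assumes b: "b \<in> pos_weights" and A: "mfps_subalgebra A" and T: "T \<subseteq> A - {0}"
    and gen: "exp_set r A b = add_submonoid hull ((\<lambda>g. lead_exp r g b) ` T)"
    and f: "f \<in> A" "f \<noteq> 0"
  shows "init_form f b \<in> mfps_subalgebra hull ((\<lambda>g. init_form g b) ` T)" (is "_ \<in> ?B")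
  using f
proof (induction "lead_exp r f b" arbitrary: f rule: wf_induct_rule[OF r_wf, case_names less])
  case (less f)
  have B: "mfps_subalgebra ?B" by (rule mfps_subalgebra_hull)
  have "exp_set r A b \<subseteq> {lead_exp r g b | g. g \<in> A \<and> g \<noteq> 0 \<and> init_form g b \<in> ?B}"
    unfolding gen using T
    by (intro hull_minimal add_submonoid_exp_set b A B) (auto intro: hull_inc)
  moreover have "lead_exp r f b \<in> exp_set r A b" using less by (auto simp: exp_set_def)
  ultimately obtain g where g: "g \<in> A" "g \<noteq> 0" "init_form g b \<in> ?B"
    and lead: "lead_exp r g b = lead_exp r f b" by auto
  define \<mu> where "\<mu> = lead_exp r f b"
  define c where "c = coeff f \<mu> / coeff g \<mu>"
  \<comment> \<open>The leading terms of \<open>f\<close> and \<open>Const c * g\<close> cancel.\<close>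
  define f' where "f' = f - Const c * g"
  have "coeff g \<mu> \<noteq> 0" using lead_exp_in_Supp[OF b g(2)] lead by (simp add: Supp_def \<mu>_def)
  then have f'\<mu>: "coeff f' \<mu> = 0" by (simp add: f'_def c_def coeff_Const_mult)
  have f': "f' \<in> A" unfolding f'_def using A less.prems(1) g(1) by (rule subalgebra_scale_diff)
  have nuf: "nu f b = wt b \<mu>" and nug: "nu g b = wt b \<mu>"
    using nu_eq_wt_lead_exp[OF b less.prems(2)] nu_eq_wt_lead_exp[OF b g(2)] lead
    by (simp_all add: \<mu>_def)
  have leads_f': "leads b \<mu> \<alpha>" if "\<alpha> \<in> Supp f'" for \<alpha>
  proof -
    have "\<alpha> \<in> Supp f \<or> \<alpha> \<in> Supp g" using that by (auto simp: Supp_def f'_def coeff_Const_mult)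
    then show ?thesis
      using lead_exp_leads[OF b less.prems(2)] lead_exp_leads[OF b g(2)] lead by (auto simp: \<mu>_def)
  qed
  have cg: "Const c * init_form g b \<in> ?B" using B g(3) by (intro subalgebra_mult subalgebra_Const)
  show ?case
  proof (cases "f' \<noteq> 0 \<and> nu f' b = wt b \<mu>")
    case True
    define \<eta> where "\<eta> = lead_exp r f' b"
    have \<eta>: "\<eta> \<in> Supp f'" "wt b \<eta> = wt b \<mu>"
      using lead_exp_in_Supp[OF b, of f'] nu_eq_wt_lead_exp[OF b, of f'] True
      by (simp_all add: \<eta>_def)
    have "\<eta> \<noteq> \<mu>" using \<eta>(1) f'\<mu> by (auto simp: Supp_def)
    moreover have "(\<eta>, \<mu>) \<in> r" using leads_f'[OF \<eta>(1)] \<eta>(2) by (simp add: leads_def)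
    ultimately have "(lead_exp r f' b, lead_exp r f b) \<in> r - Id" by (simp add: \<eta>_def \<mu>_def)
    then have "init_form f' b \<in> ?B" using f' True by (intro less.hyps) simp_all
    moreover have "init_form f b = init_form f' b + Const c * init_form g b"
      using True by (intro mfps_eqI) (simp add: coeff_init_form coeff_Const_mult nuf nug f'_def)
    ultimately show ?thesis using cg B by (simp add: subalgebra_add)
  next
    case False
    \<comment> \<open>Otherwise \<open>f'\<close> would have its least weight at \<open>\<mu>\<close>.\<close>
    have "coeff f' \<alpha> = 0" if "wt b \<alpha> = wt b \<mu>" for \<alpha>
    proof (rule ccontr)
      assume "coeff f' \<alpha> \<noteq> 0"
      then have \<alpha>: "\<alpha> \<in> Supp f'" by (simp add: Supp_def)
      have "nu f' b = wt b \<alpha>"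
        using \<alpha> leads_wt[OF leads_f'] that by (intro nu_eqI) simp_all
      moreover have "f' \<noteq> 0" using \<alpha> by (auto simp: Supp_def)
      ultimately show False using False that by simp
    qed
    then have "init_form f b = Const c * init_form g b"
      by (intro mfps_eqI) (simp add: coeff_init_form coeff_Const_mult nuf nug f'_def)
    then show ?thesis using cg by simp
  qed
qed

lemma init_alg_eq_powser_alg:
  fixes A :: "('k::field, 'n) mfps set"
  assumes b: "b \<in> pos_weights" and A: "mfps_subalgebra A" and T: "T \<subseteq> A - {0}"
    and gen: "exp_set r A b = add_submonoid hull ((\<lambda>g. lead_exp r g b) ` T)"
  shows "init_alg A b = powser_alg ((\<lambda>g. init_form g b) ` T)"
proof -
  have "mfps_subalgebra hull {init_form f b | f. f \<in> A - {0}} =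
      mfps_subalgebra hull ((\<lambda>g. init_form g b) ` T)"
  proof
    show "mfps_subalgebra hull {init_form f b | f. f \<in> A - {0}} \<subseteq>
        mfps_subalgebra hull ((\<lambda>g. init_form g b) ` T)"
    proof (rule hull_minimal)
      show "mfps_subalgebra (mfps_subalgebra hull ((\<lambda>g. init_form g b) ` T))"
        by (rule mfps_subalgebra_hull)
      show "{init_form f b | f. f \<in> A - {0}} \<subseteq> mfps_subalgebra hull ((\<lambda>g. init_form g b) ` T)"
      proof
        fix h assume "h \<in> {init_form f b | f. f \<in> A - {0}}"
        then obtain f where "f \<in> A" "f \<noteq> 0" "h = init_form f b" by blast
        then show "h \<in> mfps_subalgebra hull ((\<lambda>g. init_form g b) ` T)"
          using init_form_in_hull[OF assms, of f] by simp
      qed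
    qed
    show "mfps_subalgebra hull ((\<lambda>g. init_form g b) ` T) \<subseteq>
        mfps_subalgebra hull {init_form f b | f. f \<in> A - {0}}"
      by (rule hull_mono) (use T in blast)
  qed
  then show ?thesis by (simp add: init_alg_def powser_alg_def)
qed

end


section \<open>The partition\<close>

theorem theorem41:
  fixes r :: "(nat ^ 'n::finite) rel"
    and f :: "nat \<Rightarrow> ('k::field, 'n) mfps" and s :: nat
    and A :: "('k, 'n) mfps set"
  assumes wo: "well_order_on UNIV r"
    and compat: "\<And>\<alpha> \<beta> \<gamma>. (\<alpha>, \<beta>) \<in> r \<Longrightarrow> (\<alpha> + \<gamma>, \<beta> + \<gamma>) \<in> r"
    and nz: "\<And>i. i \<in> {1..s} \<Longrightarrow> f i \<noteq> 0"
    and A: "A = powser_alg (f ` {1..s})"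
    and fg: "\<And>a. a \<in> pos_weights \<Longrightarrow> fin_gen_semigroup (exp_set r A a)"
    and fin: "finite {lead_alg r A a | a. a \<in> pos_weights}"
  shows "\<exists>P. partition_on pos_weights P \<and>
    (\<forall>\<sigma>\<in>P. rational_polyhedral_cone \<sigma> \<and>
      (\<forall>a\<in>\<sigma>. \<forall>b\<in>\<sigma>. exp_set r A a = exp_set r A b \<and> init_alg A a = init_alg A b))"
proof -
  interpret additive_well_order r using wo compat by unfold_locales
  have clA: "closed_subalgebra A" unfolding A by (rule closed_subalgebra_powser_alg)
  then have subA: "mfps_subalgebra A" by (simp add: closed_subalgebra_def)
  \<comment> \<open>The basis is chosen per set of exponents, not per weight, so that weights with the same exponents are compared on the same series.\<close>
  define basis where "basis H T \<longleftrightarrow> finite T \<and> T \<subseteq> A - {0} \<and>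
      (\<forall>b\<in>pos_weights. exp_set r A b = H \<longrightarrow>
        exp_set r A b = add_submonoid hull ((\<lambda>g. lead_exp r g b) ` T))" for H T
  have "\<forall>H\<in>exp_set r A ` pos_weights. \<exists>T. basis H T"
    using ex_reduced_basis[OF _ clA fg] by (auto simp: basis_def)
  from bchoice[OF this] obtain T where T: "\<forall>H\<in>exp_set r A ` pos_weights. basis H (T H)" ..
  define U where "U a = T (exp_set r A a)" for a
  have U: "finite (U a)" "U a \<subseteq> A - {0}"
    "exp_set r A a = add_submonoid hull ((\<lambda>g. lead_exp r g a) ` U a)" if "a \<in> pos_weights" for a
    using T that by (auto simp: basis_def U_def)
  define R where "R = {(a, b). a \<in> pos_weights \<and> b \<in> pos_weights \<and>
      (\<forall>g\<in>U a. init_form g a = init_form g b)}"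
  have R: "exp_set r A b = exp_set r A a" "U b = U a" if "(a, b) \<in> R" for a b
  proof -
    have a: "a \<in> pos_weights" and b: "b \<in> pos_weights"
      and eq: "\<forall>g\<in>U a. init_form g a = init_form g b"
      using that by (simp_all add: R_def)
    show "exp_set r A b = exp_set r A a"
      using a b clA U(2,3)[OF a] eq by (rule exp_set_eq_if_init_forms_eq)
    then show "U b = U a" by (simp add: U_def)
  qed
  have "equiv pos_weights R"
  proof (rule equivI)
    show "R \<subseteq> pos_weights \<times> pos_weights" by (auto simp: R_def)
    show "refl_on pos_weights R" by (auto simp: R_def refl_on_def)
    show "sym R"
    proof (rule symI)
      fix a b assume ab: "(a, b) \<in> R"
      then show "(b, a) \<in> R" using R(2)[OF ab] by (simp add: R_def)
    qed
    show "trans R"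
    proof (rule transI)
      fix a b c assume ab: "(a, b) \<in> R" and bc: "(b, c) \<in> R"
      show "(a, c) \<in> R" using ab bc R(2)[OF ab] by (simp add: R_def)
    qed
  qed
  then have "partition_on pos_weights (pos_weights // R)" by (rule partition_on_quotient)
  moreover have "rational_polyhedral_cone \<sigma> \<and>
      (\<forall>a\<in>\<sigma>. \<forall>b\<in>\<sigma>. exp_set r A a = exp_set r A b \<and> init_alg A a = init_alg A b)"
    if block: "\<sigma> \<in> pos_weights // R" for \<sigma>
  proof -
    obtain a where a: "a \<in> pos_weights" and \<sigma>: "\<sigma> = R `` {a}" using block by (rule quotientE)
    have "\<sigma> = {b \<in> pos_weights. \<forall>g\<in>U a. init_form g a = init_form g b}"
      using a by (auto simp: \<sigma> R_def)
    then have "rational_polyhedral_cone \<sigma>"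
      using rational_polyhedral_cone_init_forms[OF a U(1)[OF a]] U(2)[OF a] by auto
    moreover have "exp_set r A b = exp_set r A a \<and> init_alg A b = init_alg A a" if "b \<in> \<sigma>" for b
    proof -
      have ab: "(a, b) \<in> R" using that by (simp add: \<sigma>)
      then have b: "b \<in> pos_weights" and eq: "\<forall>g\<in>U a. init_form g a = init_form g b"
        by (auto simp: R_def)
      have "init_alg A b = powser_alg ((\<lambda>g. init_form g b) ` U a)"
        using init_alg_eq_powser_alg[OF b subA U(2,3)[OF b]] R(2)[OF ab] by simp
      also have "(\<lambda>g. init_form g b) ` U a = (\<lambda>g. init_form g a) ` U a"
        using eq by (intro image_cong) simp_all
      also have "powser_alg \<dots> = init_alg A a"
        using init_alg_eq_powser_alg[OF a subA U(2,3)[OF a]] by simp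
      finally show ?thesis using R(1)[OF ab] by simp
    qed
    ultimately show ?thesis by metis
  qed
  ultimately show ?thesis by blast
qed

end
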